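(* There exists a universal constant $K>0$ such that for every $n\in\mathbb{N}$, every $1\le p<2$ and every $T\in \mathbb{M}_{2^n}$ with $0\le T\le \mathbf{1}$ and $\mathrm{var}(T)>0$, $$\max_{j\in [n]}\|\mathbf{d}_{j}(T)\|^{p}_{L_{p}}\;\ge\; \frac{1}{4}\exp\left\{-\left(\frac{K}{2-p}\right)\cdot\frac{\sum_{j=1}^{n}\|\mathbf{d}_{j}(T)\|^{p}_{L_{p}}}{\mathrm{var}(T)}\right\}.$$
   Context: $n\ge 1$ is an integer, $[n]=\{1,\dots,n\}$. $\mathbb{M}_{2^n}=M_2(\mathbb{C})^{\otimes n}$ is the algebra of complex $2^n\times 2^n$ matrices with unit $\mathbf{1}$, equipped with the normalized trace $\mathrm{tr}$ (so $\mathrm{tr}(\mathbf{1})=1$). For $1\le p<\infty$, $\|T\|_{L_p}=(\mathrm{tr}(|T|^p))^{1/p}$ with $|T|=(T^*T)^{1/2}$. The variance is $\mathrm{var}(T)=\mathrm{tr}(|T|^2)-|\mathrm{tr}(T)|^2=\|T-\mathrm{tr}(T)\mathbf{1}\|_{L_2}^2$. The $j$-th partial derivative is the linear map $\mathbf{d}_j=\mathrm{id}^{\otimes(j-1)}\otimes D\otimes \mathrm{id}^{\otimes(n-j)}$ on $\mathbb{M}_{2^n}$, where $D:M_2(\mathbb{C})\to M_2(\mathbb{C})$ is $D(A)=A-\mathrm{tr}(A)\mathbf{1}_2$ ($\mathrm{tr}$ being the normalized trace on $M_2(\mathbb{C})$). The order $0\le T\le\mathbf{1}$ is the operator (Loewner)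 order. *)

theory Defs
  imports Complex_Main "Jordan_Normal_Form.Schur_Decomposition"
begin

definition ntrace :: "complex mat \<Rightarrow> complex" where
  "ntrace A = (\<Sum>i<dim_row A. A $$ (i, i)) / of_nat (dim_row A)"

text \<open>Loewner order. The comparison in \<open>\<complex>\<close> is that of Complex-Order:
  \<open>0 \<le> z\<close> means that \<open>z\<close> is real and nonnegative.\<close>

definition psd :: "nat \<Rightarrow> complex mat \<Rightarrow> bool" where
  "psd N A \<longleftrightarrow> A \<in> carrier_mat N N \<and> mat_adjoint A = A \<and>
     (\<forall>v \<in> carrier_vec N. 0 \<le> (A *\<^sub>v v) \<bullet>c v)"

definition loewner_le :: "nat \<Rightarrow> complex mat \<Rightarrow> complex mat \<Rightarrow> bool" where
  "loewner_le N A B \<longleftrightarrow> A \<in> carrier_mat N N \<and> B \<in> carrier_mat N N \<and> psd N (B - A)"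

text \<open>Functional calculus for Hermitian matrices: \<open>f(U diag(d) U\<^sup>*) = U diag(f(d)) U\<^sup>*\<close>
  for unitary \<open>U\<close> and real \<open>d\<close>. The predicate \<open>similar_mat_wit\<close> with witnesses \<open>U\<close> and
  \<open>U\<^sup>*\<close> contains the unitarity of \<open>U\<close>. The value does not depend on the diagonalization,
  see \<open>hermitian_fun_eqI\<close> below; it is unspecified if \<open>A\<close> is not Hermitian.\<close>

definition hermitian_fun :: "(real \<Rightarrow> real) \<Rightarrow> complex mat \<Rightarrow> complex mat" where
  "hermitian_fun f A = (THE B. \<exists>U d.
     similar_mat_wit A (mat_diag (dim_row A) (\<lambda>i. complex_of_real (d i))) U (mat_adjoint U) \<and>
     B = U * mat_diag (dim_row A) (\<lambda>i. complex_of_real (f (d i))) * mat_adjoint U)"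

definition mat_abs :: "complex mat \<Rightarrow> complex mat" where
  "mat_abs T = hermitian_fun sqrt (mat_adjoint T * T)"

definition Lp_norm :: "real \<Rightarrow> complex mat \<Rightarrow> real" where
  "Lp_norm p T = Re (ntrace (hermitian_fun (\<lambda>x. x powr p) (mat_abs T))) powr (1 / p)"

definition variance :: "complex mat \<Rightarrow> real" where
  "variance T = Re (ntrace (mat_abs T ^\<^sub>m 2)) - (cmod (ntrace T))\<^sup>2"

definition kron :: "complex mat \<Rightarrow> complex mat \<Rightarrow> complex mat" where
  "kron A B = mat (dim_row A * dim_row B) (dim_col A * dim_col B) (\<lambda>(i, j).
     A $$ (i div dim_row B, j div dim_col B) * B $$ (i mod dim_row B, j mod dim_col B))"

definition matrix_unit :: "nat \<Rightarrow> nat \<Rightarrow> nat \<Rightarrow> complex mat" where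
  "matrix_unit N i j = mat N N (\<lambda>ij. if ij = (i, j) then 1 else 0)"

text \<open>The tensor product \<open>\<Phi> \<otimes> \<Psi>\<close> of linear maps \<open>\<Phi>\<close> on \<open>M\<^sub>a(\<complex>)\<close> and \<open>\<Psi>\<close> on \<open>M\<^sub>b(\<complex>)\<close>,
  acting on \<open>M\<^sub>a(\<complex>) \<otimes> M\<^sub>b(\<complex>) = M\<^sub>a\<^sub>b(\<complex>)\<close>: the linear extension of
  \<open>E\<^sub>i\<^sub>j \<otimes> E\<^sub>k\<^sub>l \<mapsto> \<Phi>(E\<^sub>i\<^sub>j) \<otimes> \<Psi>(E\<^sub>k\<^sub>l)\<close>, written entrywise. The coefficient of
  \<open>E\<^sub>i\<^sub>j \<otimes> E\<^sub>k\<^sub>l\<close> in \<open>T\<close> is the entry of \<open>T\<close> at \<open>(i * b + k, j * b + l)\<close>.\<close>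

definition tensor_map :: "nat \<Rightarrow> nat \<Rightarrow> (complex mat \<Rightarrow> complex mat) \<Rightarrow>
    (complex mat \<Rightarrow> complex mat) \<Rightarrow> complex mat \<Rightarrow> complex mat" where
  "tensor_map a b \<Phi> \<Psi> T = mat (a * b) (a * b) (\<lambda>rs.
     \<Sum>i<a. \<Sum>j<a. \<Sum>k<b. \<Sum>l<b. T $$ (i * b + k, j * b + l) *
       kron (\<Phi> (matrix_unit a i j)) (\<Psi> (matrix_unit b k l)) $$ rs)"

primrec tensor_maps :: "(complex mat \<Rightarrow> complex mat) list \<Rightarrow> complex mat \<Rightarrow> complex mat" where
  "tensor_maps [] = id"
| "tensor_maps (\<Phi> # \<Phi>s) = tensor_map 2 (2 ^ length \<Phi>s) \<Phi> (tensor_maps \<Phi>s)"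

definition D_map :: "complex mat \<Rightarrow> complex mat" where
  "D_map A = A - ntrace A \<cdot>\<^sub>m 1\<^sub>m 2"

text \<open>The factors are numbered \<open>1, \<dots>, n\<close>; the definition is meant for \<open>1 \<le> j \<le> n\<close>.\<close>

definition partial_deriv :: "nat \<Rightarrow> nat \<Rightarrow> complex mat \<Rightarrow> complex mat" where
  "partial_deriv n j = tensor_maps (replicate (j - 1) id @ [D_map] @ replicate (n - j) id)"


lemma hermitian_fun_wit_unique:
  fixes d e :: "nat \<Rightarrow> real"
  assumes A: "A \<in> carrier_mat N N"
    and U: "similar_mat_wit A (mat_diag N (\<lambda>i. complex_of_real (d i))) U (mat_adjoint U)"
    and V: "similar_mat_wit A (mat_diag N (\<lambda>i. complex_of_real (e i))) V (mat_adjoint V)"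
  shows "U * mat_diag N (\<lambda>i. complex_of_real (f (d i))) * mat_adjoint U =
         V * mat_diag N (\<lambda>i. complex_of_real (f (e i))) * mat_adjoint V"
proof -
  let ?Du = "mat_diag N (\<lambda>i. complex_of_real (d i))"
  let ?Dv = "mat_diag N (\<lambda>i. complex_of_real (e i))"
  let ?Fu = "mat_diag N (\<lambda>i. complex_of_real (f (d i)))"
  let ?Fv = "mat_diag N (\<lambda>i. complex_of_real (f (e i)))"
  define U' V' where "U' = mat_adjoint U" and "V' = mat_adjoint V"
  note u = similar_mat_witD2[OF A U, folded U'_def]
  note v = similar_mat_witD2[OF A V, folded V'_def]
  define W where "W = V' * U"
  have W: "W \<in> carrier_mat N N" unfolding W_def using u v by auto
  have Fu: "?Fu \<in> carrier_mat N N" and Fv: "?Fv \<in> carrier_mat N N" by auto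
  note c = u(5-) v(5-)
  note u1 = u(1,2) and v1 = v(1,2)
  note assoc = mult_carrier_mat[of _ N N _ N] assoc_mult_mat[of _ N N _ N _ N]
  have "?Dv * W = V' * V * (?Dv * (V' * U))" using c v1 by (simp add: W_def assoc(1) left_mult_one_mat[of _ N N])
  also have "\<dots> = V' * A * U"
    unfolding v(3) using c by (simp add: assoc)
  also have "\<dots> = V' * U * (?Du * (U' * U))"
    unfolding u(3) using c by (simp add: assoc)
  also have "\<dots> = W * ?Du" using c u1 by (simp add: W_def assoc(1) right_mult_one_mat[of _ N N])
  finally have eq: "?Dv * W = W * ?Du" .
  have "?Fv * W = W * ?Fu"
  proof (rule eq_matI)
    fix i j assume "i < dim_row (W * ?Fu)" "j < dim_col (W * ?Fu)"
    hence ij: "i < N" "j < N" using W by (auto simp: mat_diag_def)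
    from arg_cong[OF eq, of "\<lambda>M. M $$ (i, j)"] ij W
    have "complex_of_real (e i) * W $$ (i, j) = W $$ (i, j) * complex_of_real (d j)"
      by (simp add: mat_diag_mult_left[OF W] mat_diag_mult_right[OF W])
    hence "W $$ (i, j) = 0 \<or> e i = d j" by auto
    thus "(?Fv * W) $$ (i, j) = (W * ?Fu) $$ (i, j)" using ij W
      by (auto simp: mat_diag_mult_left[OF W] mat_diag_mult_right[OF W])
  qed (use W in \<open>auto simp: mat_diag_def\<close>)
  hence "V * (?Fv * W) * U' = V * (W * ?Fu) * U'" by simp
  moreover have "V * (?Fv * W) * U' = V * ?Fv * V'"
  proof -
    have "V * (?Fv * W) * U' = V * ?Fv * V' * (U * U')"
      unfolding W_def using c by (simp add: assoc)
    thus ?thesis using c u1 by (simp add: assoc(1) right_mult_one_mat[of _ N N])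
  qed
  moreover have "V * (W * ?Fu) * U' = U * ?Fu * U'"
  proof -
    have "V * (W * ?Fu) * U' = V * V' * (U * ?Fu * U')"
      unfolding W_def using c by (simp add: assoc)
    thus ?thesis using c v1 by (simp add: assoc(1) left_mult_one_mat[of _ N N])
  qed
  ultimately show ?thesis unfolding U'_def V'_def by simp
qed

lemma hermitian_fun_eqI:
  assumes A: "A \<in> carrier_mat N N"
    and U: "similar_mat_wit A (mat_diag N (\<lambda>i. complex_of_real (d i))) U (mat_adjoint U)"
  shows "hermitian_fun f A = U * mat_diag N (\<lambda>i. complex_of_real (f (d i))) * mat_adjoint U"
proof -
  have dim: "dim_row A = N" using A by auto
  show ?thesis unfolding hermitian_fun_def dim
  proof (rule the_equality)
    show "\<exists>U' d'. similar_mat_wit A (mat_diag N (\<lambda>i. complex_of_real (d' i))) U' (mat_adjoint U') \<and>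
      U * mat_diag N (\<lambda>i. complex_of_real (f (d i))) * mat_adjoint U =
      U' * mat_diag N (\<lambda>i. complex_of_real (f (d' i))) * mat_adjoint U'"
      using U by blast
  qed (use hermitian_fun_wit_unique[OF A _ U] in blast)
qed

end

theory Submission
  imports Defs "HOL-Analysis.L2_Norm"
begin

text \<open>The argument is Talagrand's: compare Fourier weights with the help of a noise operator, and gain from
  hypercontractivity. Fix an orthonormal basis of \<open>M\<^sub>2(\<complex>)\<close> that contains \<open>\<one>\<close>, and expand \<open>T\<close> in
  the product basis of \<open>M\<^sub>2(\<complex>)\<^sup>\<otimes>\<^sup>n\<close>, with coefficients \<open>c s\<close> for words \<open>s\<close> over four letters. The derivative
  \<open>d\<^sub>j\<close> keeps exactly the words with \<open>s\<^sub>j \<noteq> 0\<close>. Hence \<open>var T\<close> is the sum of \<open>|c s|\<^sup>2\<close> over the words of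
  nonzero weight (the weight counts nonzero letters), and in \<open>\<Sum>\<^sub>j \<parallel>d\<^sub>j T\<parallel>\<^sub>2\<^sup>2\<close> each word is counted as often
  as its weight says. Let \<open>N\<close> be the noise operator that multiplies \<open>c s\<close> by \<open>(1/5)\<close> to the weight of
  \<open>s\<close>. An elementary inequality between \<open>L\<close> and the weight (\<open>log_le_weight\<close>) yields, for every real \<open>L\<close>,
  \<open>L var T \<le> C \<Sum>\<^sub>j (\<parallel>d\<^sub>j T\<parallel>\<^sub>2\<^sup>2 + e\<^sup>L \<parallel>N d\<^sub>j T\<parallel>\<^sub>2\<^sup>2)\<close> with a universal constant \<open>C\<close>.

  Write \<open>I\<^sub>j = \<parallel>d\<^sub>j T\<parallel>\<^sub>p\<^sup>p\<close> and \<open>M = max\<^sub>j I\<^sub>j\<close>. The operator \<open>d\<^sub>j T = T - E\<^sub>j T\<close> is Hermitian, and it lies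
  between \<open>-\<one>\<close> and \<open>\<one>\<close> because the conditional expectation \<open>E\<^sub>j\<close> is positive and unital
  (\<open>kraus_cond_exp\<close>). Its eigenvalues are thus at most 1 in modulus, so \<open>\<parallel>d\<^sub>j T\<parallel>\<^sub>2\<^sup>2 \<le> I\<^sub>j\<close>.
  Hypercontractivity improves this to \<open>\<parallel>N d\<^sub>j T\<parallel>\<^sub>2\<^sup>2 \<le> I\<^sub>j\<^sup>1\<^sup>+\<^sup>\<alpha>\<close> with \<open>\<alpha> = 1 - p/2\<close>
  (\<open>noise_contraction\<close>). The choice \<open>e\<^sup>L = M\<^sup>-\<^sup>\<alpha>\<close> makes both terms at most \<open>I\<^sub>j\<close>, and
  \<open>\<alpha> log(1/M) var T \<le> 2 C \<Sum>\<^sub>j I\<^sub>j\<close> gives the assertion (\<open>influence_inequality\<close>).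

  The hypercontractive estimate is needed only from \<open>L\<^sub>2\<close> to \<open>L\<^sub>4\<close> and with some constant in place of the
  sharp one. The fourth power of the 4-norm is the polynomial \<open>tr (A\<^sup>* A A\<^sup>* A)\<close>, so an induction on
  the number of factors that uses no more than Hoelder's inequality is enough (\<open>bonami\<close>). It is then
  dualized against a diagonalized Hermitian matrix.

  In this analysis a matrix is a function \<open>nat \<Rightarrow> nat \<Rightarrow> complex\<close>, of which only the entries below the
  dimension count; norms and inner products are not normalized, so the powers of 2 are explicit.
  The last sections translate the matrix notions of the theorem into this language.\<close>

section \<open>The Schatten 4-norm\<close>

type_synonym cmatrix = "nat \<Rightarrow> nat \<Rightarrow> complex"

definition hs_inner :: "nat \<Rightarrow> cmatrix \<Rightarrow> cmatrix \<Rightarrow> complex" where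
  "hs_inner N F G = (\<Sum>i<N. \<Sum>j<N. cnj (F i j) * G i j)"

definition hs_sq :: "nat \<Rightarrow> cmatrix \<Rightarrow> real" where
  "hs_sq N F = (\<Sum>i<N. \<Sum>j<N. (cmod (F i j))\<^sup>2)"

text \<open>\<open>A\<^sup>* B\<close>\<close>

definition adj_mult :: "nat \<Rightarrow> cmatrix \<Rightarrow> cmatrix \<Rightarrow> nat \<Rightarrow> nat \<Rightarrow> complex" where
  "adj_mult N A B = (\<lambda>i k. \<Sum>j<N. cnj (A j i) * B j k)"

text \<open>\<open>tr (A\<^sup>* B C\<^sup>* D)\<close>, a form that is additive in each argument and turns the 4-norm into a polynomial.\<close>

definition trace4 :: "nat \<Rightarrow> cmatrix \<Rightarrow> cmatrix \<Rightarrow>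
    cmatrix \<Rightarrow> cmatrix \<Rightarrow> complex" where
  "trace4 N A B C D = (\<Sum>i<N. \<Sum>j<N. \<Sum>k<N. \<Sum>l<N.
     cnj (A j i) * B j k * cnj (C l k) * D l i)"

text \<open>\<open>tr |A|\<^sup>4 = \<parallel>A\<^sup>* A\<parallel>\<^sub>2\<^sup>2\<close>, without normalization.\<close>

definition schatten4_pow4 :: "nat \<Rightarrow> cmatrix \<Rightarrow> real" where
  "schatten4_pow4 N A = hs_sq N (adj_mult N A A)"

definition schatten4 :: "nat \<Rightarrow> cmatrix \<Rightarrow> real" where
  "schatten4 N A = sqrt (sqrt (schatten4_pow4 N A))"

lemma cauchy_schwarz_sum:
  fixes f g :: "'a \<Rightarrow> complex"
  shows "(cmod (\<Sum>x\<in>I. f x * g x))\<^sup>2 \<le> (\<Sum>x\<in>I. (cmod (f x))\<^sup>2) * (\<Sum>x\<in>I. (cmod (g x))\<^sup>2)"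
proof -
  have "cmod (\<Sum>x\<in>I. f x * g x) \<le> (\<Sum>x\<in>I. \<bar>cmod (f x)\<bar> * \<bar>cmod (g x)\<bar>)"
    using norm_sum[of "\<lambda>x. f x * g x" I] by (simp add: norm_mult)
  also have "\<dots> \<le> L2_set (\<lambda>x. cmod (f x)) I * L2_set (\<lambda>x. cmod (g x)) I"
    by (rule L2_set_mult_ineq)
  finally have "(cmod (\<Sum>x\<in>I. f x * g x))\<^sup>2 \<le> \<dots>\<^sup>2"
    by (intro power_mono) auto
  thus ?thesis
    by (simp add: power_mult_distrib L2_set_def sum_nonneg)
qed

lemma hs_sq_nonneg [simp]: "0 \<le> hs_sq N F"
  by (simp add: hs_sq_def sum_nonneg)

lemma schatten4_pow4_nonneg [simp]: "0 \<le> schatten4_pow4 N F"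
  by (simp add: schatten4_pow4_def)

lemma schatten4_nonneg [simp]: "0 \<le> schatten4 N F"
  by (simp add: schatten4_def)

lemma schatten4_power4: "schatten4 N F ^ 4 = schatten4_pow4 N F"
proof -
  have "schatten4 N F ^ 4 = ((schatten4 N F)\<^sup>2)\<^sup>2" by simp
  thus ?thesis by (simp add: schatten4_def)
qed

lemma schatten4_power2: "(schatten4 N F)\<^sup>2 = sqrt (schatten4_pow4 N F)"
  by (simp add: schatten4_def)

lemma hs_sq_eq_hs_inner: "complex_of_real (hs_sq N F) = hs_inner N F F"
  by (simp add: hs_sq_def hs_inner_def complex_norm_square mult.commute del: of_real_power)

lemma hs_inner_cauchy_schwarz: "(cmod (hs_inner N F G))\<^sup>2 \<le> hs_sq N F * hs_sq N G"
proof -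
  have "hs_inner N F G = (\<Sum>x\<in>{..<N}\<times>{..<N}. cnj (F (fst x) (snd x)) * G (fst x) (snd x))"
    by (simp add: hs_inner_def sum.cartesian_product case_prod_unfold)
  moreover have "hs_sq N H = (\<Sum>x\<in>{..<N}\<times>{..<N}. (cmod (H (fst x) (snd x)))\<^sup>2)" for H
    by (simp add: hs_sq_def sum.cartesian_product case_prod_unfold)
  ultimately show ?thesis
    using cauchy_schwarz_sum[of "\<lambda>x. cnj (F (fst x) (snd x))" "\<lambda>x. G (fst x) (snd x)" "{..<N}\<times>{..<N}"]
    by simp
qed

lemma trace4_eq_hs_inner: "trace4 N A B C D = hs_inner N (adj_mult N B A) (adj_mult N C D)"
proof -
  have "hs_inner N (adj_mult N B A) (adj_mult N C D) =
    (\<Sum>k<N. \<Sum>i<N. \<Sum>j<N. \<Sum>l<N. cnj (A j i) * B j k * cnj (C l k) * D l i)"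
    by (simp add: hs_inner_def adj_mult_def sum_product mult_ac)
  also have "\<dots> = (\<Sum>i<N. \<Sum>k<N. \<Sum>j<N. \<Sum>l<N. cnj (A j i) * B j k * cnj (C l k) * D l i)"
    by (rule sum.swap)
  also have "\<dots> = trace4 N A B C D"
    unfolding trace4_def by (rule sum.cong[OF refl], rule sum.swap)
  finally show ?thesis by simp
qed

lemma schatten4_pow4_eq_trace4: "complex_of_real (schatten4_pow4 N A) = trace4 N A A A A"
  by (simp add: schatten4_pow4_def hs_sq_eq_hs_inner trace4_eq_hs_inner)

text \<open>By cyclicity of the trace, \<open>\<parallel>A\<^sup>* B\<parallel>\<^sub>2\<^sup>2 = tr (A A\<^sup>* B B\<^sup>*)\<close>. This is an inner product of \<open>A A\<^sup>*\<close> and \<open>B B\<^sup>*\<close>, and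
  \<open>\<parallel>A A\<^sup>*\<parallel>\<^sub>2 = \<parallel>A\<^sup>* A\<parallel>\<^sub>2\<close> (the case \<open>A = B\<close>), so the Cauchy--Schwarz inequality suffices.\<close>

lemma hs_sq_adj_mult_le: "hs_sq N (adj_mult N A B) \<le> sqrt (schatten4_pow4 N A) * sqrt (schatten4_pow4 N B)"
proof -
  \<comment> \<open>\<open>R A\<close> is \<open>A A\<^sup>*\<close> up to conjugation of the entries.\<close>
  define R where "R A = (\<lambda>j l. \<Sum>i<N. cnj (A j i) * A l i)" for A :: "nat \<Rightarrow> nat \<Rightarrow> complex"
  have eq: "complex_of_real (hs_sq N (adj_mult N A B)) = hs_inner N (R A) (R B)" for A B
  proof -
    have "complex_of_real (hs_sq N (adj_mult N A B)) =
      (\<Sum>i<N. \<Sum>k<N. \<Sum>j<N. \<Sum>l<N. A j i * cnj (A l i) * (cnj (B j k) * B l k))"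
      by (simp add: hs_sq_eq_hs_inner hs_inner_def adj_mult_def sum_product mult_ac)
    also have "\<dots> = (\<Sum>i<N. \<Sum>j<N. \<Sum>k<N. \<Sum>l<N. A j i * cnj (A l i) * (cnj (B j k) * B l k))"
      by (rule sum.cong[OF refl], rule sum.swap)
    also have "\<dots> = (\<Sum>j<N. \<Sum>i<N. \<Sum>k<N. \<Sum>l<N. A j i * cnj (A l i) * (cnj (B j k) * B l k))"
      by (rule sum.swap)
    also have "\<dots> = (\<Sum>j<N. \<Sum>i<N. \<Sum>l<N. \<Sum>k<N. A j i * cnj (A l i) * (cnj (B j k) * B l k))"
      by (rule sum.cong[OF refl], rule sum.cong[OF refl], rule sum.swap)
    also have "\<dots> = (\<Sum>j<N. \<Sum>l<N. \<Sum>i<N. \<Sum>k<N. A j i * cnj (A l i) * (cnj (B j k) * B l k))"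
      by (rule sum.cong[OF refl], rule sum.swap)
    also have "\<dots> = hs_inner N (R A) (R B)"
      by (simp add: hs_inner_def R_def sum_product)
    finally show ?thesis .
  qed
  have "complex_of_real (hs_sq N (R A)) = complex_of_real (schatten4_pow4 N A)" for A
    using eq[of A A] by (simp add: hs_sq_eq_hs_inner schatten4_pow4_def)
  hence R: "hs_sq N (R A) = schatten4_pow4 N A" for A by simp
  have "hs_sq N (adj_mult N A B) = cmod (hs_inner N (R A) (R B))"
    unfolding eq[symmetric] by simp
  also have "\<dots> \<le> sqrt (hs_sq N (R A) * hs_sq N (R B))"
    using hs_inner_cauchy_schwarz by (rule real_le_rsqrt)
  finally show ?thesis by (simp add: R real_sqrt_mult)
qed

text \<open>Hoelder's inequality for four exponents 4, by two applications of the Cauchy--Schwarz inequality.\<close>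

lemma trace4_hoelder: "cmod (trace4 N A B C D) \<le> schatten4 N A * schatten4 N B * schatten4 N C * schatten4 N D"
proof -
  have "(cmod (trace4 N A B C D))\<^sup>2 \<le> hs_sq N (adj_mult N B A) * hs_sq N (adj_mult N C D)"
    unfolding trace4_eq_hs_inner by (rule hs_inner_cauchy_schwarz)
  also have "\<dots> \<le> (sqrt (schatten4_pow4 N B) * sqrt (schatten4_pow4 N A)) * (sqrt (schatten4_pow4 N C) * sqrt (schatten4_pow4 N D))"
    by (intro mult_mono hs_sq_adj_mult_le) auto
  also have "\<dots> = (schatten4 N A * schatten4 N B * schatten4 N C * schatten4 N D)\<^sup>2"
    by (simp add: schatten4_power2[symmetric] power_mult_distrib)
  finally show ?thesis
    by (rule power2_le_imp_le) simp
qed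

lemma trace4_add:
  "trace4 N (\<lambda>i j. A i j + A' i j) B C D = trace4 N A B C D + trace4 N A' B C D"
  "trace4 N A (\<lambda>i j. B i j + B' i j) C D = trace4 N A B C D + trace4 N A B' C D"
  "trace4 N A B (\<lambda>i j. C i j + C' i j) D = trace4 N A B C D + trace4 N A B C' D"
  "trace4 N A B C (\<lambda>i j. D i j + D' i j) = trace4 N A B C D + trace4 N A B C D'"
  by (simp_all add: trace4_def algebra_simps sum.distrib)

text \<open>With \<open>S = A + B\<close>, expand one factor of \<open>tr (S\<^sup>* S S\<^sup>* S)\<close> and apply Hoelder's inequality.\<close>

lemma schatten4_triangle: "schatten4 N (\<lambda>i j. A i j + B i j) \<le> schatten4 N A + schatten4 N B"
proof -
  define S where "S = (\<lambda>i j. A i j + B i j)"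
  have "complex_of_real (schatten4_pow4 N S) = trace4 N A S S S + trace4 N B S S S"
    unfolding schatten4_pow4_eq_trace4 by (subst (1) S_def) (simp add: trace4_add)
  hence "\<bar>schatten4_pow4 N S\<bar> = cmod (trace4 N A S S S + trace4 N B S S S)"
    by (metis norm_of_real)
  also have "\<dots> \<le> cmod (trace4 N A S S S) + cmod (trace4 N B S S S)"
    by (rule norm_triangle_ineq)
  also have "\<dots> \<le> schatten4 N A * schatten4 N S * schatten4 N S * schatten4 N S + schatten4 N B * schatten4 N S * schatten4 N S * schatten4 N S"
    by (intro add_mono trace4_hoelder)
  finally have "schatten4 N S * schatten4 N S ^ 3 \<le> (schatten4 N A + schatten4 N B) * schatten4 N S ^ 3"
    by (simp add: schatten4_power4[symmetric] power3_eq_cube power4_eq_xxxx algebra_simps)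
  thus ?thesis
    unfolding S_def[symmetric]
    using schatten4_nonneg[of N S] schatten4_nonneg[of N A] schatten4_nonneg[of N B]
    by (cases "schatten4 N S = 0") (auto simp: mult_le_cancel_right)
qed

lemma schatten4_scale: "schatten4 N (\<lambda>i j. complex_of_real c * A i j) = \<bar>c\<bar> * schatten4 N A"
proof -
  have "adj_mult N (\<lambda>i j. complex_of_real c * A i j) (\<lambda>i j. complex_of_real c * A i j)
     = (\<lambda>i j. complex_of_real (c\<^sup>2) * adj_mult N A A i j)"
    by (simp add: adj_mult_def sum_distrib_left power2_eq_square mult_ac)
  hence "schatten4_pow4 N (\<lambda>i j. complex_of_real c * A i j) = ((c\<^sup>2))\<^sup>2 * schatten4_pow4 N A"
    by (simp add: schatten4_pow4_def hs_sq_def sum_distrib_left norm_mult power_mult_distrib norm_power)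
  hence "schatten4 N (\<lambda>i j. complex_of_real c * A i j) = sqrt (sqrt ((c\<^sup>2)\<^sup>2)) * schatten4 N A"
    by (simp add: schatten4_def real_sqrt_mult)
  thus ?thesis unfolding real_sqrt_abs by simp
qed

text \<open>The hypothesis says that the terms linear in \<open>R\<close> vanish. The other terms of the expansion are bounded by
  Hoelder's inequality: six of order \<open>a\<^sup>2r\<^sup>2\<close>, four of order \<open>ar\<^sup>3\<close>, one \<open>r\<^sup>4\<close>; then \<open>2ar \<le> a\<^sup>2 + r\<^sup>2\<close>.\<close>

lemma schatten4_pow4_perturbation:
  assumes "trace4 N A A A R = 0" "trace4 N A A R A = 0" "trace4 N A R A A = 0" "trace4 N R A A A = 0"
  shows "schatten4_pow4 N (\<lambda>i j. A i j + R i j) \<le>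
    schatten4 N A ^ 4 + 8 * (schatten4 N A)\<^sup>2 * (schatten4 N R)\<^sup>2 + 3 * schatten4 N R ^ 4"
proof -
  let ?a = "schatten4 N A" and ?r = "schatten4 N R"
  have r: "Re (trace4 N B C D E) \<le> schatten4 N B * schatten4 N C * schatten4 N D * schatten4 N E" for B C D E
    using trace4_hoelder complex_Re_le_cmod order_trans by blast
  have "schatten4_pow4 N (\<lambda>i j. A i j + R i j) = Re (complex_of_real (schatten4_pow4 N (\<lambda>i j. A i j + R i j)))" by simp
  also have "\<dots> = Re (trace4 N A A A A) +
     (Re (trace4 N A A R R) + Re (trace4 N A R A R) + Re (trace4 N A R R A) + Re (trace4 N R A A R)
      + Re (trace4 N R A R A) + Re (trace4 N R R A A)) +
     (Re (trace4 N A R R R) + Re (trace4 N R A R R) + Re (trace4 N R R A R) + Re (trace4 N R R R A))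
     + Re (trace4 N R R R R)"
    unfolding schatten4_pow4_eq_trace4 by (simp add: trace4_add assms)
  also have "\<dots> \<le> ?a*?a*?a*?a + (?a*?a*?r*?r + ?a*?r*?a*?r + ?a*?r*?r*?a + ?r*?a*?a*?r + ?r*?a*?r*?a + ?r*?r*?a*?a)
     + (?a*?r*?r*?r + ?r*?a*?r*?r + ?r*?r*?a*?r + ?r*?r*?r*?a) + ?r*?r*?r*?r"
    by (intro add_mono r)
  also have "\<dots> = ?a^4 + 6 * ?a\<^sup>2 * ?r\<^sup>2 + 2 * ?r\<^sup>2 * (2 * ?a * ?r) + ?r ^ 4"
    by (simp add: power2_eq_square power4_eq_xxxx algebra_simps)
  also have "\<dots> \<le> ?a^4 + 6 * ?a\<^sup>2 * ?r\<^sup>2 + 2 * ?r\<^sup>2 * (?a\<^sup>2 + ?r\<^sup>2) + ?r ^ 4"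
    by (intro add_mono mult_left_mono order_refl sum_squares_bound) auto
  also have "\<dots> = ?a ^ 4 + 8 * ?a\<^sup>2 * ?r\<^sup>2 + 3 * ?r ^ 4"
    by (simp add: power2_eq_square power4_eq_xxxx algebra_simps)
  finally show ?thesis .
qed

section \<open>Fourier expansion in a product basis\<close>

lemma sum_lessThan_double:
  fixes f :: "nat \<Rightarrow> 'a::comm_monoid_add"
  shows "(\<Sum>i<2*N. f i) = (\<Sum>i<N. f i + f (N + i))"
proof -
  have "(\<Sum>i<N+M. f i) = (\<Sum>i<N. f i) + (\<Sum>i<M. f (N + i))" for M
    by (induction M) (simp_all add: add.assoc)
  thus ?thesis by (simp add: sum.distrib mult_2)
qed

text \<open>The element \<open>\<one> \<otimes> G\<^sub>0 + Z \<otimes> G\<^sub>1 + \<surd>2 E\<^sub>0\<^sub>1 \<otimes> G\<^sub>2 + \<surd>2 E\<^sub>1\<^sub>0 \<otimes> G\<^sub>3\<close> of \<open>M\<^sub>2 \<otimes> M\<^sub>N\<close>, where \<open>Z = diag(1, -1)\<close>. The four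
  matrices are orthonormal for the normalized trace of \<open>M\<^sub>2\<close>. Compared with the Pauli basis they have the
  advantage that the two off-diagonal blocks stay separate.\<close>

definition assemble :: "nat \<Rightarrow> (nat \<Rightarrow> nat \<Rightarrow> nat \<Rightarrow> complex) \<Rightarrow> nat \<Rightarrow> nat \<Rightarrow> complex" where
  "assemble N G x y =
    (if x < N then if y < N then G 0 x y + G 1 x y else complex_of_real (sqrt 2) * G 2 x (y - N)
     else if y < N then complex_of_real (sqrt 2) * G 3 (x - N) y else G 0 (x - N) (y - N) - G 1 (x - N) (y - N))"

text \<open>The coordinates inverse to \<open>assemble\<close>; component 0 is the normalized partial trace over the first factor.\<close>

definition component :: "nat \<Rightarrow> cmatrix \<Rightarrow> nat \<Rightarrow> nat \<Rightarrow> nat \<Rightarrow> complex" where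
  "component N F i = (\<lambda>x y.
     if i = 0 then (F x y + F (N + x) (N + y)) / 2
     else if i = 1 then (F x y - F (N + x) (N + y)) / 2
     else if i = 2 then F x (N + y) / complex_of_real (sqrt 2)
     else F (N + x) y / complex_of_real (sqrt 2))"

primrec indices :: "nat \<Rightarrow> nat list set" where
  "indices 0 = {[]}"
| "indices (Suc n) = (\<lambda>(i, s). i # s) ` ({..<4} \<times> indices n)"

text \<open>The first letter of a word belongs to the first tensor factor. The letter 0 stands for \<open>\<one>\<close>, so the
  coefficient of the word of zeros is the normalized trace.\<close>

primrec fourier :: "nat \<Rightarrow> cmatrix \<Rightarrow> nat list \<Rightarrow> complex" where
  "fourier 0 F = (\<lambda>s. F 0 0)"
| "fourier (Suc n) F = (\<lambda>s. fourier n (component (2 ^ n) F (hd s)) (tl s))"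

primrec inv_fourier :: "nat \<Rightarrow> (nat list \<Rightarrow> complex) \<Rightarrow> nat \<Rightarrow> nat \<Rightarrow> complex" where
  "inv_fourier 0 c = (\<lambda>x y. c [])"
| "inv_fourier (Suc n) c = assemble (2 ^ n) (\<lambda>i. inv_fourier n (\<lambda>s. c (i # s)))"

definition weight :: "nat list \<Rightarrow> nat" where
  "weight s = length (filter (\<lambda>i. i \<noteq> 0) s)"

lemma sum_lessThan_4: "(\<Sum>i<4. f i) = f 0 + f 1 + f 2 + f (3::nat)"
  by (simp add: eval_nat_numeral)

lemma finite_indices [simp]: "finite (indices n)"
  by (induction n) auto

lemma length_indices: "s \<in> indices n \<Longrightarrow> length s = n"
  by (induction n arbitrary: s) auto

lemma sum_indices_Suc:
  "(\<Sum>s\<in>indices (Suc n). f s) = (\<Sum>i<4. \<Sum>s\<in>indices n. f (i # s))"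
proof -
  have "(\<Sum>s\<in>indices (Suc n). f s) = (\<Sum>(i,s)\<in>{..<4} \<times> indices n. f (i # s))"
    unfolding indices.simps by (subst sum.reindex) (auto simp: inj_on_def case_prod_unfold)
  thus ?thesis by (simp add: sum.cartesian_product)
qed

lemma weight_simps [simp]: "weight [] = 0" "weight (i # s) = (if i = 0 then 0 else 1) + weight s"
  by (simp_all add: weight_def)

lemma sqrt2_mult: "complex_of_real (sqrt 2) * (complex_of_real (sqrt 2) * z) = 2 * z"
  by (metis mult.assoc of_real_mult of_real_numeral real_sqrt_mult_self abs_numeral)

lemma fourier_cong:
  "(\<And>x y. x < 2 ^ n \<Longrightarrow> y < 2 ^ n \<Longrightarrow> F x y = G x y) \<Longrightarrow> fourier n F s = fourier n G s"
proof (induction n arbitrary: F G s)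
  case (Suc n)
  show ?case unfolding fourier.simps
    by (rule Suc.IH) (auto simp: component_def Suc.prems)
qed simp

lemma component_assemble:
  assumes "x < N" "y < N" "i < 4"
  shows "component N (assemble N G) i x y = G i x y"
proof -
  have "i = 0 \<or> i = 1 \<or> i = 2 \<or> i = 3" using assms by auto
  thus ?thesis using assms by (auto simp: component_def assemble_def)
qed

lemma fourier_inv_fourier: "s \<in> indices n \<Longrightarrow> fourier n (inv_fourier n c) s = c s"
proof (induction n arbitrary: c s)
  case (Suc n)
  then obtain i t where s: "s = i # t" "i < 4" "t \<in> indices n" by auto
  have "fourier (Suc n) (inv_fourier (Suc n) c) s = fourier n (inv_fourier n (\<lambda>s. c (i # s))) t"
    using s by (auto intro!: fourier_cong simp: component_assemble)
  thus ?case using s Suc.IH by simp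
qed simp

lemma fourier_add: "fourier n (\<lambda>x y. F x y + G x y) s = fourier n F s + fourier n G s"
proof (induction n arbitrary: F G s)
  case (Suc n)
  have "component (2 ^ n) (\<lambda>x y. F x y + G x y) i =
    (\<lambda>x y. component (2 ^ n) F i x y + component (2 ^ n) G i x y)" for i
    by (auto simp: component_def fun_eq_iff add_divide_distrib diff_divide_distrib)
  thus ?case by (simp add: Suc.IH)
qed simp

lemma fourier_scale: "fourier n (\<lambda>x y. a * F x y) s = a * fourier n F s"
proof (induction n arbitrary: F s)
  case (Suc n)
  have "component (2 ^ n) (\<lambda>x y. a * F x y) i = (\<lambda>x y. a * component (2 ^ n) F i x y)" for i
    by (auto simp: component_def fun_eq_iff add_divide_distrib diff_divide_distrib algebra_simps)
  thus ?case by (simp add: Suc.IH)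
qed simp

lemma inv_fourier_scale: "inv_fourier n (\<lambda>s. a * c s) = (\<lambda>x y. a * inv_fourier n c x y)"
proof (induction n arbitrary: c)
  case (Suc n)
  show ?case by (auto simp: Suc.IH assemble_def fun_eq_iff algebra_simps)
qed simp

lemma hs_inner_split: "hs_inner (2 * N) F G = 2 * (\<Sum>i<4. hs_inner N (component N F i) (component N G i))"
proof -
  have *: "cnj a * b + cnj a' * b' = 2 * (cnj ((a + a') / 2) * ((b + b') / 2)
     + cnj ((a - a') / 2) * ((b - b') / 2))" for a b a' b' :: complex
    by (simp add: field_simps)
  have **: "cnj a * b = 2 * (cnj (a / complex_of_real (sqrt 2)) * (b / complex_of_real (sqrt 2)))" for a b :: complex
    by (simp add: field_simps flip: of_real_mult)
  have "hs_inner (2 * N) F G = (\<Sum>x<N. \<Sum>y<N. (cnj (F x y) * G x y + cnj (F (N + x) (N + y)) * G (N + x) (N + y))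
     + (cnj (F x (N + y)) * G x (N + y)) + (cnj (F (N + x) y) * G (N + x) y))"
    unfolding hs_inner_def sum_lessThan_double by (simp add: sum.distrib add_ac)
  also have "\<dots> = (\<Sum>x<N. \<Sum>y<N. 2 * (\<Sum>i<4. cnj (component N F i x y) * component N G i x y))"
  proof (intro sum.cong refl)
    fix x y
    show "(cnj (F x y) * G x y + cnj (F (N + x) (N + y)) * G (N + x) (N + y))
      + cnj (F x (N + y)) * G x (N + y) + cnj (F (N + x) y) * G (N + x) y
      = 2 * (\<Sum>i<4. cnj (component N F i x y) * component N G i x y)"
      unfolding sum_lessThan_4 *[of "F x y" "G x y" "F (N + x) (N + y)" "G (N + x) (N + y)"]
        **[of "F x (N + y)" "G x (N + y)"] **[of "F (N + x) y" "G (N + x) y"]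
      by (simp add: component_def distrib_left)
  qed
  also have "\<dots> = 2 * (\<Sum>i<4. hs_inner N (component N F i) (component N G i))"
    by (simp add: hs_inner_def sum_lessThan_4 sum.distrib sum_distrib_left distrib_left)
  finally show ?thesis .
qed

text \<open>The product basis is orthonormal for the normalized trace, hence the factor \<open>2\<^sup>n\<close>.\<close>

lemma parseval: "hs_inner (2 ^ n) F G = 2 ^ n * (\<Sum>s\<in>indices n. cnj (fourier n F s) * fourier n G s)"
proof (induction n arbitrary: F G)
  case 0 show ?case by (simp add: hs_inner_def)
next
  case (Suc n)
  show ?case
    by (simp add: hs_inner_split Suc.IH sum_indices_Suc sum_distrib_left mult.assoc del: indices.simps)
qed

lemma parseval_hs_sq: "hs_sq (2 ^ n) F = 2 ^ n * (\<Sum>s\<in>indices n. (cmod (fourier n F s))\<^sup>2)"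
proof -
  have "complex_of_real (hs_sq (2 ^ n) F) = complex_of_real (2 ^ n * (\<Sum>s\<in>indices n. (cmod (fourier n F s))\<^sup>2))"
    unfolding hs_sq_eq_hs_inner parseval of_real_mult of_real_sum complex_norm_square
    by (simp add: mult.commute)
  thus ?thesis by (simp only: of_real_eq_iff)
qed

section \<open>Hypercontractivity\<close>

definition embed :: "nat \<Rightarrow> nat \<Rightarrow> cmatrix \<Rightarrow> nat \<Rightarrow> nat \<Rightarrow> complex" where
  "embed N i A = assemble N (\<lambda>j. if j = i then A else (\<lambda>x y. 0))"

lemma assemble_eq_sum_embed:
  "assemble N G = (\<lambda>x y. embed N 0 (G 0) x y + (embed N 1 (G 1) x y + embed N 2 (G 2) x y + embed N 3 (G 3) x y))"
  by (auto simp: embed_def assemble_def fun_eq_iff)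

lemma embed_entries:
  assumes "x < N" "y < N"
  shows "embed N 0 A x y = A x y" "embed N 0 A x (N + y) = 0" "embed N 0 A (N + x) y = 0" "embed N 0 A (N + x) (N + y) = A x y"
    "embed N (Suc 0) A x y = A x y" "embed N (Suc 0) A x (N + y) = 0" "embed N (Suc 0) A (N + x) y = 0" "embed N (Suc 0) A (N + x) (N + y) = - A x y"
    "embed N 2 A x y = 0" "embed N 2 A x (N + y) = complex_of_real (sqrt 2) * A x y" "embed N 2 A (N + x) y = 0" "embed N 2 A (N + x) (N + y) = 0"
    "embed N 3 A x y = 0" "embed N 3 A x (N + y) = 0" "embed N 3 A (N + x) y = complex_of_real (sqrt 2) * A x y" "embed N 3 A (N + x) (N + y) = 0"
  using assms by (auto simp: embed_def assemble_def)

lemma adj_mult_double: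
  "adj_mult (2 * N) F G i k = (\<Sum>j<N. cnj (F j i) * G j k + cnj (F (N + j) i) * G (N + j) k)"
  unfolding adj_mult_def by (rule sum_lessThan_double)

lemma hs_inner_cong:
  assumes "\<And>x y. x < N \<Longrightarrow> y < N \<Longrightarrow> F x y = F' x y" "\<And>x y. x < N \<Longrightarrow> y < N \<Longrightarrow> G x y = G' x y"
  shows "hs_inner N F G = hs_inner N F' G'"
  unfolding hs_inner_def by (intro sum.cong refl) (simp add: assms)

lemma component_adj_mult_embed_0_0:
  assumes "x < N" "y < N"
  shows "component N (adj_mult (2 * N) (embed N 0 A) (embed N 0 B)) k x y = (if k = 0 then adj_mult N A B x y else 0)"
  using assms unfolding component_def adj_mult_double by (simp add: embed_entries adj_mult_def)

text \<open>The products of \<open>\<one>\<close> with one of the other basis elements are traceless; this is what removes the linear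
  terms in the induction step of \<open>bonami\<close>.\<close>

lemma component_adj_mult_embed_off:
  assumes "x < N" "y < N" "0 < i" "i < 4"
  shows "component N (adj_mult (2 * N) (embed N 0 A) (embed N i B)) 0 x y = 0"
    "component N (adj_mult (2 * N) (embed N i B) (embed N 0 A)) 0 x y = 0"
proof -
  have "i = Suc 0 \<or> i = 2 \<or> i = 3" using assms by auto
  thus "component N (adj_mult (2 * N) (embed N 0 A) (embed N i B)) 0 x y = 0"
    "component N (adj_mult (2 * N) (embed N i B) (embed N 0 A)) 0 x y = 0"
    using assms(1,2) unfolding component_def adj_mult_double
    by (elim disjE; simp add: embed_entries sum_negf)+
qed

lemma component_adj_mult_embed_diag:
  assumes "x < N" "y < N" "i < 4"
  shows "component N (adj_mult (2 * N) (embed N i A) (embed N i A)) k x y =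
    (if k = 0 then adj_mult N A A x y
     else if k = 1 then (if i < 2 then 0 else if i = 2 then - adj_mult N A A x y else adj_mult N A A x y) else 0)"
proof -
  have s: "complex_of_real (sqrt 2) * a * (complex_of_real (sqrt 2) * b) = 2 * (a * b)" for a b
    by (metis mult.assoc mult.left_commute sqrt2_mult)
  have "i = 0 \<or> i = Suc 0 \<or> i = 2 \<or> i = 3" using assms by auto
  thus ?thesis
    using assms(1,2) unfolding component_def adj_mult_double
    by (elim disjE; simp add: embed_entries s adj_mult_def sum_distrib_left[symmetric])
qed

text \<open>The diagonal basis elements are unitary; \<open>\<surd>2 E\<^sub>0\<^sub>1\<close> and \<open>\<surd>2 E\<^sub>1\<^sub>0\<close> have \<open>tr |X|\<^sup>4 = 4\<close>.\<close>

lemma schatten4_pow4_embed: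
  assumes "i < 4"
  shows "schatten4_pow4 (2 * N) (embed N i A) = (if i < 2 then 2 else 4) * schatten4_pow4 N A"
proof -
  let ?M = "adj_mult (2 * N) (embed N i A) (embed N i A)" and ?A = "adj_mult N A A"
  have "hs_inner N (component N ?M k) (component N ?M k) = (if k = 0 \<or> k = 1 \<and> 2 \<le> i then hs_inner N ?A ?A else 0)" for k
  proof -
    have "hs_inner N (component N ?M k) (component N ?M k) =
       hs_inner N (\<lambda>x y. (if k = 0 then ?A x y
     else if k = 1 then (if i < 2 then 0 else if i = 2 then - ?A x y else ?A x y) else 0))
     (\<lambda>x y. (if k = 0 then ?A x y
     else if k = 1 then (if i < 2 then 0 else if i = 2 then - ?A x y else ?A x y) else 0))"
      by (rule hs_inner_cong) (simp_all only: component_adj_mult_embed_diag assms)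
    also have "\<dots> = (if k = 0 \<or> k = 1 \<and> 2 \<le> i then hs_inner N ?A ?A else 0)"
      unfolding hs_inner_def by (cases "k = 0"; cases "k = 1"; cases "i < 2"; cases "i = 2"; simp)
    finally show ?thesis .
  qed
  hence "hs_inner (2 * N) ?M ?M = (if i < 2 then 2 else 4) * hs_inner N ?A ?A"
    unfolding hs_inner_split sum_lessThan_4 by simp
  hence "complex_of_real (schatten4_pow4 (2 * N) (embed N i A)) = complex_of_real ((if i < 2 then 2 else 4) * schatten4_pow4 N A)"
    unfolding schatten4_pow4_def hs_sq_eq_hs_inner by (simp add: hs_sq_eq_hs_inner)
  thus ?thesis by (simp only: of_real_eq_iff)
qed

lemma hs_inner_adj_mult_embed_off:
  assumes "0 < i" "i < 4"
  shows "hs_inner (2 * N) (adj_mult (2 * N) (embed N 0 A) (embed N 0 A)) (adj_mult (2 * N) (embed N 0 A) (embed N i B)) = 0"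
    "hs_inner (2 * N) (adj_mult (2 * N) (embed N 0 A) (embed N 0 A)) (adj_mult (2 * N) (embed N i B) (embed N 0 A)) = 0"
    "hs_inner (2 * N) (adj_mult (2 * N) (embed N 0 A) (embed N i B)) (adj_mult (2 * N) (embed N 0 A) (embed N 0 A)) = 0"
    "hs_inner (2 * N) (adj_mult (2 * N) (embed N i B) (embed N 0 A)) (adj_mult (2 * N) (embed N 0 A) (embed N 0 A)) = 0"
proof -
  have z: "hs_inner N (component N (adj_mult (2 * N) (embed N 0 A) (embed N 0 A)) k) (component N M k) = 0"
    "hs_inner N (component N M k) (component N (adj_mult (2 * N) (embed N 0 A) (embed N 0 A)) k) = 0"
    if M: "\<And>x y. x < N \<Longrightarrow> y < N \<Longrightarrow> component N M 0 x y = 0" for M k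
    unfolding hs_inner_def using M
    by (auto intro!: sum.neutral simp: component_adj_mult_embed_0_0)
  note off = component_adj_mult_embed_off[OF _ _ assms]
  show "hs_inner (2 * N) (adj_mult (2 * N) (embed N 0 A) (embed N 0 A)) (adj_mult (2 * N) (embed N 0 A) (embed N i B)) = 0"
    "hs_inner (2 * N) (adj_mult (2 * N) (embed N 0 A) (embed N 0 A)) (adj_mult (2 * N) (embed N i B) (embed N 0 A)) = 0"
    "hs_inner (2 * N) (adj_mult (2 * N) (embed N 0 A) (embed N i B)) (adj_mult (2 * N) (embed N 0 A) (embed N 0 A)) = 0"
    "hs_inner (2 * N) (adj_mult (2 * N) (embed N i B) (embed N 0 A)) (adj_mult (2 * N) (embed N 0 A) (embed N 0 A)) = 0"
    unfolding hs_inner_split by (simp_all only: z off sum.neutral_const mult_zero_right)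
qed

lemma trace4_embed_off:
  assumes "0 < i" "i < 4"
  shows "trace4 (2 * N) (embed N 0 A) (embed N 0 A) (embed N 0 A) (embed N i B) = 0"
    "trace4 (2 * N) (embed N 0 A) (embed N 0 A) (embed N i B) (embed N 0 A) = 0"
    "trace4 (2 * N) (embed N 0 A) (embed N i B) (embed N 0 A) (embed N 0 A) = 0"
    "trace4 (2 * N) (embed N i B) (embed N 0 A) (embed N 0 A) (embed N 0 A) = 0"
  unfolding trace4_eq_hs_inner by (simp_all only: hs_inner_adj_mult_embed_off[OF assms])

lemma schatten4_embed_0: "(schatten4 (2 * N) (embed N 0 A))\<^sup>2 = sqrt 2 * (schatten4 N A)\<^sup>2"
  by (simp add: schatten4_power2 schatten4_pow4_embed real_sqrt_mult)

lemma schatten4_embed_le: "i < 4 \<Longrightarrow> schatten4 (2 * N) (embed N i A) \<le> sqrt 2 * schatten4 N A"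
proof -
  assume i: "i < 4"
  have "schatten4_pow4 (2 * N) (embed N i A) \<le> 4 * schatten4_pow4 N A"
    using schatten4_pow4_nonneg[of N A] by (simp add: schatten4_pow4_embed[OF i])
  hence "schatten4 (2 * N) (embed N i A) \<le> sqrt (sqrt (4 * schatten4_pow4 N A))"
    by (simp add: schatten4_def)
  thus ?thesis by (simp add: schatten4_def real_sqrt_mult)
qed

text \<open>Induction on the number of factors. The matrix splits into the part \<open>X\<close> that is constant in the first
  factor and a remainder \<open>R\<close> that carries a factor 1/5. The terms linear in \<open>R\<close> vanish, so the increase of the fourth
  power is of second order in 1/5. It is therefore absorbed by the mixed and the last term
  of \<open>(S\<^sub>0 + s)\<^sup>2\<close>, where \<open>S\<^sub>0\<close> and \<open>s\<close> sum \<open>|c|\<^sup>2\<close> over the words with first letter zero and nonzero.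
  The value 1/5 is small enough to pay for the triangle inequality in \<open>R\<close>; it is not optimal.\<close>

lemma bonami:
  "schatten4_pow4 (2 ^ n) (inv_fourier n (\<lambda>s. complex_of_real ((1/5) ^ weight s) * c s))
     \<le> 2 ^ n * (\<Sum>s\<in>indices n. (cmod (c s))\<^sup>2)\<^sup>2"
proof (induction n arbitrary: c)
  case 0
  show ?case by (simp add: schatten4_pow4_def hs_sq_def adj_mult_def norm_mult power2_eq_square)
next
  case (Suc n)
  define N :: nat where "N = 2 ^ n"
  define U where "U i = inv_fourier n (\<lambda>s. complex_of_real ((1/5) ^ weight s) * c (i # s))" for i
  define S where "S i = (\<Sum>s\<in>indices n. (cmod (c (i # s)))\<^sup>2)" for i
  define b where "b i = schatten4 N (U i)" for i
  define h where "h = sqrt (2 ^ n)"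
  define s where "s = S 1 + S 2 + S 3"
  have S0: "S i \<ge> 0" for i by (simp add: S_def sum_nonneg)
  have h0: "h > 0" and hh: "h\<^sup>2 = 2 ^ n" by (simp_all add: h_def)
  have b0: "b i \<ge> 0" for i by (simp add: b_def)
  have b: "(b i)\<^sup>2 \<le> h * S i" for i
  proof -
    have "(b i)\<^sup>2 = sqrt (schatten4_pow4 (2 ^ n) (U i))" by (simp add: b_def schatten4_power2 N_def)
    also have "\<dots> \<le> sqrt (2 ^ n * (S i)\<^sup>2)"
      unfolding U_def S_def real_sqrt_le_iff by (rule Suc.IH)
    also have "\<dots> = h * S i" using S0[of i] by (simp add: h_def real_sqrt_mult)
    finally show ?thesis .
  qed
  define V where "V i = (\<lambda>x y. complex_of_real (1/5) * U i x y)" for i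
  define X where "X = embed N 0 (U 0)"
  define R where "R = (\<lambda>x y. embed N 1 (V 1) x y + (embed N 2 (V 2) x y + embed N 3 (V 3) x y))"
  have "inv_fourier (Suc n) (\<lambda>s. complex_of_real ((1/5) ^ weight s) * c s)
      = assemble N (\<lambda>i. if i = 0 then U 0 else V i)"
  proof -
    have "inv_fourier n (\<lambda>s. complex_of_real ((1/5) ^ weight (i # s)) * c (i # s)) = (if i = 0 then U 0 else V i)" for i
    proof (cases "i = 0")
      case False
      have "(\<lambda>s. complex_of_real ((1/5) ^ weight (i # s)) * c (i # s))
          = (\<lambda>s. complex_of_real (1/5) * (complex_of_real ((1/5) ^ weight s) * c (i # s)))"
        using False by (simp add: fun_eq_iff)
      thus ?thesis using False by (simp only: inv_fourier_scale U_def V_def if_False)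
    qed (simp add: U_def)
    thus ?thesis unfolding inv_fourier.simps N_def by presburger
  qed
  also have "\<dots> = (\<lambda>x y. X x y + R x y)"
    unfolding assemble_eq_sum_embed[of N "\<lambda>i. if i = 0 then U 0 else V i"] by (simp add: X_def R_def add.assoc)
  finally have F: "inv_fourier (Suc n) (\<lambda>s. complex_of_real ((1/5) ^ weight s) * c s) = (\<lambda>x y. X x y + R x y)" .
  define x r where "x = schatten4 (2 * N) X" and "r = schatten4 (2 * N) R"
  have x2: "x\<^sup>2 \<le> sqrt 2 * (h * S 0)"
    using b[of 0] by (simp add: x_def X_def schatten4_embed_0 b_def)
  have r0: "r \<ge> 0" by (simp add: r_def)
  have "schatten4 (2 * N) (embed N i (V i)) \<le> sqrt 2 / 5 * b i" if "i < 4" for i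
  proof -
    have "schatten4 N (V i) = b i / 5"
      using schatten4_scale[of N "1/5" "U i"] by (simp add: V_def b_def)
    thus ?thesis using schatten4_embed_le[OF that, of N "V i"] by (simp only: times_divide_eq_left times_divide_eq_right)
  qed
  hence e: "schatten4 (2 * N) (embed N 1 (V 1)) \<le> sqrt 2 / 5 * b 1" "schatten4 (2 * N) (embed N 2 (V 2)) \<le> sqrt 2 / 5 * b 2"
    "schatten4 (2 * N) (embed N 3 (V 3)) \<le> sqrt 2 / 5 * b 3" by simp_all
  have "r \<le> sqrt 2 / 5 * b 1 + (sqrt 2 / 5 * b 2 + sqrt 2 / 5 * b 3)"
    unfolding r_def R_def
    by (rule order_trans[OF schatten4_triangle] add_mono e)+
  hence "r \<le> sqrt 2 / 5 * (b 1 + b 2 + b 3)" by (simp only: distrib_left add.assoc)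
  hence "r\<^sup>2 \<le> (sqrt 2 / 5 * (b 1 + b 2 + b 3))\<^sup>2" using r0 by (rule power_mono)
  also have "\<dots> = 2 / 25 * (b 1 + b 2 + b 3)\<^sup>2" by (simp add: power_mult_distrib power_divide)
  also have "(b 1 + b 2 + b 3)\<^sup>2 \<le> 3 * ((b 1)\<^sup>2 + (b 2)\<^sup>2 + (b 3)\<^sup>2)"
    using sum_squares_ge_zero[of "b 1 - b 2" "b 2 - b 3"] zero_le_power2[of "b 1 - b 3"]
    by (simp add: power2_eq_square algebra_simps)
  also have "\<dots> \<le> 3 * (h * S 1 + h * S 2 + h * S 3)" by (intro mult_left_mono add_mono b) auto
  also have "\<dots> = 3 * (h * s)" by (simp add: s_def algebra_simps)
  finally have r2: "r\<^sup>2 \<le> 6 / 25 * (h * s)" by simp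
  have s0: "s \<ge> 0" using S0 by (simp add: s_def)
  have "schatten4_pow4 (2 * N) (\<lambda>x y. X x y + R x y) \<le> x ^ 4 + 8 * x\<^sup>2 * r\<^sup>2 + 3 * r ^ 4"
    unfolding x_def r_def
    by (rule schatten4_pow4_perturbation) (simp_all add: X_def R_def trace4_add trace4_embed_off)
  also have "\<dots> = (x\<^sup>2)\<^sup>2 + 8 * (x\<^sup>2 * r\<^sup>2) + 3 * (r\<^sup>2)\<^sup>2" by simp
  also have "\<dots> \<le> (sqrt 2 * (h * S 0))\<^sup>2 + 8 * ((3 / 2 * (h * S 0)) * (6 / 25 * (h * s))) + 3 * (6 / 25 * (h * s))\<^sup>2"
  proof (intro add_mono mult_left_mono mult_mono power_mono x2 r2)
    have "sqrt 2 \<le> 3 / 2" by (rule real_le_lsqrt) (simp_all add: power2_eq_square)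
    hence "sqrt 2 * (h * S 0) \<le> 3 / 2 * (h * S 0)" using h0 S0 by (intro mult_right_mono) auto
    thus "x\<^sup>2 \<le> 3 / 2 * (h * S 0)" using x2 by linarith
  qed (use h0 S0 s0 in auto)
  also have "\<dots> = h\<^sup>2 * (2 * (S 0)\<^sup>2 + 72 / 25 * (S 0 * s) + 108 / 625 * s\<^sup>2)"
    by (simp add: power2_eq_square algebra_simps)
  also have "\<dots> \<le> h\<^sup>2 * (2 * (S 0)\<^sup>2 + 4 * (S 0 * s) + 2 * s\<^sup>2)"
    using S0 s0 by (intro mult_left_mono add_mono mult_right_mono) auto
  also have "\<dots> = 2 * h\<^sup>2 * (S 0 + s)\<^sup>2" by (simp add: power2_eq_square algebra_simps)
  also have "\<dots> = 2 ^ Suc n * (\<Sum>s\<in>indices (Suc n). (cmod (c s))\<^sup>2)\<^sup>2"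
    by (simp only: hh sum_indices_Suc sum_lessThan_4 S_def s_def) (simp add: add_ac)
  finally show ?case unfolding F by (simp add: N_def)
qed

section \<open>Duality for Hermitian matrices\<close>

text \<open>All three numbers \<open>a\<close>, \<open>b\<close>, 1 are compared with the tangent of \<open>exp\<close> at \<open>u ln a + v ln b\<close>.\<close>

lemma weighted_amgm:
  fixes a b u v w :: real
  assumes "a > 0" "b > 0" "u \<ge> 0" "v \<ge> 0" "w \<ge> 0" "u + v + w = 1"
  shows "a powr u * b powr v \<le> u * a + v * b + w"
proof -
  define y where "y = u * ln a + v * ln b"
  have tangent: "exp y * (1 + z - y) \<le> exp z" for z
  proof -
    have "exp y * (1 + (z - y)) \<le> exp y * exp (z - y)"
      by (intro mult_left_mono exp_ge_add_one_self) simp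
    thus ?thesis by (simp add: exp_diff add_diff_eq)
  qed
  have "a powr u * b powr v = exp y"
    using assms by (simp add: powr_def y_def exp_add)
  also have "\<dots> = u * (exp y * (1 + ln a - y)) + v * (exp y * (1 + ln b - y)) + w * (exp y * (1 + 0 - y))"
  proof -
    have w: "w = 1 - u - v" using assms by simp
    show ?thesis unfolding w y_def by (simp add: algebra_simps)
  qed
  also have "\<dots> \<le> u * exp (ln a) + v * exp (ln b) + w * exp 0"
    by (intro add_mono mult_left_mono tangent assms)
  finally show ?thesis using assms by simp
qed

text \<open>Hoelder's inequality for the three functions \<open>d\<^sup>p\<close>, \<open>x\<^sup>4\<close> and 1 with weights \<open>1 - p/4\<close>, \<open>1/4\<close> and
  \<open>(p - 1)/4\<close>. The first weight times \<open>p\<close> is at most 1 because \<open>(p/2 - 1)\<^sup>2 \<ge> 0\<close>, so for \<open>d \<le> 1\<close> the product of the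
  three powers dominates \<open>d x\<close>. This one inequality covers all \<open>p\<close> between 1 and 2.\<close>

lemma hoelder_contraction:
  fixes d x :: "'a \<Rightarrow> real" and p :: real
  assumes A: "finite A" "A \<noteq> {}" and p: "1 \<le> p" "p \<le> 2"
    and d: "\<And>k. k \<in> A \<Longrightarrow> 0 \<le> d k" "\<And>k. k \<in> A \<Longrightarrow> d k \<le> 1" and x: "\<And>k. k \<in> A \<Longrightarrow> 0 \<le> x k"
  shows "(\<Sum>k\<in>A. d k * x k) / card A \<le>
    ((\<Sum>k\<in>A. d k powr p) / card A) powr (1 - p/4) * ((\<Sum>k\<in>A. x k ^ 4) / card A) powr (1/4)"
proof -
  define I where "I = (\<Sum>k\<in>A. d k powr p) / card A"
  define X where "X = (\<Sum>k\<in>A. x k ^ 4) / card A"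
  define u where "u = 1 - p / 4"
  have c: "real (card A) > 0" using A by (simp add: card_gt_0_iff)
  have nn: "I \<ge> 0" "X \<ge> 0" by (simp_all add: I_def X_def sum_nonneg)
  have u: "u \<ge> 0" using p by (simp add: u_def)
  have "(\<Sum>k\<in>A. d k * x k) / card A \<le> I powr u * X powr (1/4)"
  proof (cases "I = 0 \<or> X = 0")
    case True
    hence "(\<Sum>k\<in>A. d k powr p) = 0 \<or> (\<Sum>k\<in>A. x k ^ 4) = 0" using c by (auto simp: I_def X_def)
    hence "\<forall>k\<in>A. d k * x k = 0"
      using A by (auto simp: sum_nonneg_eq_0_iff)
    thus ?thesis by (simp add: sum.neutral)
  next
    case False
    hence IX: "I > 0" "X > 0" using nn by auto
    define E where "E = I powr u * X powr (1/4)"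
    have pt: "d k * x k \<le> E * (u * (d k powr p / I) + 1/4 * (x k ^ 4 / X) + (p - 1) / 4)" if k: "k \<in> A" for k
    proof (cases "d k = 0 \<or> x k = 0")
      case True
      have "0 \<le> E * (u * (d k powr p / I) + 1/4 * (x k ^ 4 / X) + (p - 1) / 4)"
        unfolding E_def using IX u p
        by (intro mult_nonneg_nonneg add_nonneg_nonneg) (auto simp: zero_le_even_power)
      thus ?thesis using True by auto
    next
      case False
      hence dx: "d k > 0" "x k > 0" using d(1)[OF k] x[OF k] by auto
      have "p * u \<le> 1"
        using zero_le_power2[of "p / 2 - 1"] by (simp add: u_def power2_eq_square field_simps)
      hence "d k powr 1 \<le> d k powr (p * u)"
        using dx d(2)[OF k] by (intro powr_mono') auto
      hence "d k * x k \<le> d k powr (p * u) * x k" using dx by simp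
      also have "\<dots> = d k powr (p * u) * (x k ^ 4) powr (1/4)"
        using dx by (simp add: powr_powr flip: powr_numeral)
      also have "d k powr (p * u) * (x k ^ 4) powr (1/4) = E * ((d k powr p / I) powr u * (x k ^ 4 / X) powr (1/4))"
        using IX dx by (simp add: E_def powr_divide powr_powr)
      also have "\<dots> \<le> E * (u * (d k powr p / I) + 1/4 * (x k ^ 4 / X) + (p - 1) / 4)"
        by (intro mult_left_mono weighted_amgm) (use IX dx u p in \<open>auto simp: E_def u_def field_simps\<close>)
      finally show ?thesis .
    qed
    have "(\<Sum>k\<in>A. d k * x k) \<le> (\<Sum>k\<in>A. E * (u * (d k powr p / I) + 1/4 * (x k ^ 4 / X) + (p - 1) / 4))"
      by (intro sum_mono pt)
    also have "\<dots> = E * (u * ((\<Sum>k\<in>A. d k powr p) / I) + 1/4 * ((\<Sum>k\<in>A. x k ^ 4) / X) + card A * ((p - 1) / 4))"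
      by (simp only: sum.distrib sum_distrib_left[symmetric] sum_divide_distrib[symmetric]) simp
    also have "(\<Sum>k\<in>A. d k powr p) / I = card A"
      using IX c by (auto simp: I_def field_simps)
    also have "(\<Sum>k\<in>A. x k ^ 4) / X = card A"
      using IX c by (auto simp: X_def field_simps)
    also have "E * (u * real (card A) + 1/4 * card A + card A * ((p - 1) / 4)) = E * card A"
      by (simp add: u_def field_simps)
    finally show ?thesis using c by (simp add: E_def field_simps)
  qed
  thus ?thesis by (simp add: I_def X_def u_def)
qed

text \<open>The sesquilinear form \<open>v\<^sup>* F w\<close>.\<close>

definition sesq :: "nat \<Rightarrow> cmatrix \<Rightarrow> (nat \<Rightarrow> complex) \<Rightarrow> (nat \<Rightarrow> complex) \<Rightarrow> complex" where
  "sesq N F v w = (\<Sum>i<N. \<Sum>j<N. cnj (v i) * F i j * w j)"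

definition unitary :: "nat \<Rightarrow> cmatrix \<Rightarrow> bool" where
  "unitary N U \<longleftrightarrow> (\<forall>k<N. \<forall>l<N. (\<Sum>i<N. cnj (U i k) * U i l) = (if k = l then 1 else 0)) \<and>
     (\<forall>i<N. \<forall>j<N. (\<Sum>k<N. U i k * cnj (U j k)) = (if i = j then 1 else 0))"

definition diagonalizes :: "nat \<Rightarrow> cmatrix \<Rightarrow> cmatrix \<Rightarrow> (nat \<Rightarrow> real) \<Rightarrow> bool" where
  "diagonalizes N G U d \<longleftrightarrow> unitary N U \<and>
     (\<forall>i<N. \<forall>j<N. G i j = (\<Sum>k<N. U i k * complex_of_real (d k) * cnj (U j k)))"

lemma unitary_column_norm: "unitary N U \<Longrightarrow> k < N \<Longrightarrow> (\<Sum>i<N. (cmod (U i k))\<^sup>2) = 1"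
proof -
  assume "unitary N U" "k < N"
  hence "(\<Sum>i<N. cnj (U i k) * U i k) = 1" by (simp add: unitary_def)
  hence "complex_of_real (\<Sum>i<N. (cmod (U i k))\<^sup>2) = 1"
    unfolding of_real_sum complex_norm_square by (simp add: mult.commute)
  thus ?thesis by (simp only: of_real_eq_1_iff)
qed

lemma unitary_isometry:
  assumes U: "unitary N U"
  shows "(\<Sum>k<N. (cmod (\<Sum>l<N. m l * U l k))\<^sup>2) = (\<Sum>l<N. (cmod (m l))\<^sup>2)"
proof -
  have "complex_of_real (\<Sum>k<N. (cmod (\<Sum>l<N. m l * U l k))\<^sup>2)
    = (\<Sum>k<N. \<Sum>l<N. \<Sum>j<N. m l * cnj (m j) * (U l k * cnj (U j k)))"
    unfolding of_real_sum complex_norm_square by (simp add: sum_product mult_ac)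
  also have "\<dots> = (\<Sum>l<N. \<Sum>k<N. \<Sum>j<N. m l * cnj (m j) * (U l k * cnj (U j k)))"
    by (rule sum.swap)
  also have "\<dots> = (\<Sum>l<N. \<Sum>j<N. \<Sum>k<N. m l * cnj (m j) * (U l k * cnj (U j k)))"
    by (rule sum.cong[OF refl], rule sum.swap)
  also have "\<dots> = (\<Sum>l<N. \<Sum>j<N. m l * cnj (m j) * (if l = j then 1 else 0))"
    unfolding sum_distrib_left[symmetric] using U by (intro sum.cong refl) (simp add: unitary_def)
  also have "\<dots> = (\<Sum>l<N. m l * cnj (m l))"
    by (simp add: if_distrib[of "\<lambda>z. _ * z"] sum.delta cong: if_cong)
  also have "\<dots> = complex_of_real (\<Sum>l<N. (cmod (m l))\<^sup>2)"
    unfolding of_real_sum complex_norm_square ..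
  finally show ?thesis by (simp only: of_real_eq_iff)
qed

lemma sesq_cauchy_schwarz:
  assumes "(\<Sum>i<N. (cmod (v i))\<^sup>2) = 1"
  shows "(cmod (sesq N F v v))\<^sup>2 \<le> (\<Sum>i<N. (cmod (\<Sum>j<N. F i j * v j))\<^sup>2)"
proof -
  have "sesq N F v v = (\<Sum>i<N. cnj (v i) * (\<Sum>j<N. F i j * v j))"
    by (simp add: sesq_def sum_distrib_left mult.assoc)
  thus ?thesis
    using cauchy_schwarz_sum[of "\<lambda>i. cnj (v i)" "\<lambda>i. \<Sum>j<N. F i j * v j" "{..<N}"] assms by simp
qed

lemma norm_image_eq_sesq:
  "complex_of_real (\<Sum>i<N. (cmod (\<Sum>j<N. F i j * v j))\<^sup>2) = sesq N (adj_mult N F F) v v"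
proof -
  have "complex_of_real (\<Sum>i<N. (cmod (\<Sum>j<N. F i j * v j))\<^sup>2)
    = (\<Sum>i<N. \<Sum>l<N. \<Sum>j<N. cnj (v j) * (cnj (F i j) * F i l) * v l)"
    unfolding of_real_sum complex_norm_square by (simp add: sum_product mult_ac)
  also have "\<dots> = (\<Sum>i<N. \<Sum>j<N. \<Sum>l<N. cnj (v j) * (cnj (F i j) * F i l) * v l)"
    by (rule sum.cong[OF refl], rule sum.swap)
  also have "\<dots> = (\<Sum>j<N. \<Sum>i<N. \<Sum>l<N. cnj (v j) * (cnj (F i j) * F i l) * v l)"
    by (rule sum.swap)
  also have "\<dots> = (\<Sum>j<N. \<Sum>l<N. \<Sum>i<N. cnj (v j) * (cnj (F i j) * F i l) * v l)"
    by (rule sum.cong[OF refl], rule sum.swap)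
  also have "\<dots> = sesq N (adj_mult N F F) v v"
    by (simp add: sesq_def adj_mult_def sum_distrib_left sum_distrib_right)
  finally show ?thesis .
qed

text \<open>Passing to the diagonal in an orthonormal basis does not increase the 4-norm:
  \<open>|u\<^sup>*Fu|\<^sup>4 \<le> \<parallel>Fu\<parallel>\<^sup>4 = |u\<^sup>* F\<^sup>*F u|\<^sup>2 \<le> \<parallel>F\<^sup>*F u\<parallel>\<^sup>2\<close> for unit vectors \<open>u\<close>, and the right-hand sides add up to
  \<open>\<parallel>F\<^sup>*F\<parallel>\<^sub>2\<^sup>2\<close>.\<close>

lemma sum_diagonal_power4_le_schatten4_pow4:
  assumes U: "unitary N U"
  shows "(\<Sum>k<N. cmod (sesq N F (\<lambda>i. U i k) (\<lambda>i. U i k)) ^ 4) \<le> schatten4_pow4 N F"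
proof -
  let ?M = "adj_mult N F F"
  have "cmod (sesq N F (\<lambda>i. U i k) (\<lambda>i. U i k)) ^ 4 \<le> (\<Sum>i<N. (cmod (\<Sum>j<N. ?M i j * U j k))\<^sup>2)" if k: "k < N" for k
  proof -
    note u = unitary_column_norm[OF U k]
    define z where "z = (\<Sum>i<N. (cmod (\<Sum>j<N. F i j * U j k))\<^sup>2)"
    have z0: "z \<ge> 0" by (simp add: z_def sum_nonneg)
    have "cmod (sesq N F (\<lambda>i. U i k) (\<lambda>i. U i k)) ^ 4 = ((cmod (sesq N F (\<lambda>i. U i k) (\<lambda>i. U i k)))\<^sup>2)\<^sup>2" by simp
    also have "\<dots> \<le> z\<^sup>2"
      unfolding z_def by (intro power_mono sesq_cauchy_schwarz u) auto
    also have "z = cmod (sesq N ?M (\<lambda>i. U i k) (\<lambda>i. U i k))"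
      using z0 unfolding norm_image_eq_sesq[symmetric] z_def[symmetric] by simp
    also have "\<dots>\<^sup>2 \<le> (\<Sum>i<N. (cmod (\<Sum>j<N. ?M i j * U j k))\<^sup>2)"
      by (intro sesq_cauchy_schwarz u)
    finally show ?thesis .
  qed
  hence "(\<Sum>k<N. cmod (sesq N F (\<lambda>i. U i k) (\<lambda>i. U i k)) ^ 4) \<le> (\<Sum>k<N. \<Sum>i<N. (cmod (\<Sum>j<N. ?M i j * U j k))\<^sup>2)"
    by (intro sum_mono) auto
  also have "\<dots> = (\<Sum>i<N. \<Sum>k<N. (cmod (\<Sum>j<N. ?M i j * U j k))\<^sup>2)" by (rule sum.swap)
  also have "\<dots> = schatten4_pow4 N F"
    by (simp add: unitary_isometry[OF U] schatten4_pow4_def hs_sq_def)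
  finally show ?thesis .
qed

lemma hs_inner_diagonalized:
  assumes "diagonalizes N G U d"
  shows "hs_inner N H G = (\<Sum>k<N. complex_of_real (d k) * cnj (sesq N H (\<lambda>i. U i k) (\<lambda>i. U i k)))"
proof -
  have "hs_inner N H G = (\<Sum>i<N. \<Sum>j<N. \<Sum>k<N. d k * (U i k * cnj (H i j) * cnj (U j k)))"
    unfolding hs_inner_def using assms
    by (intro sum.cong refl) (simp add: diagonalizes_def sum_distrib_left mult_ac)
  also have "\<dots> = (\<Sum>i<N. \<Sum>k<N. \<Sum>j<N. d k * (U i k * cnj (H i j) * cnj (U j k)))"
    by (rule sum.cong[OF refl], rule sum.swap)
  also have "\<dots> = (\<Sum>k<N. \<Sum>i<N. \<Sum>j<N. d k * (U i k * cnj (H i j) * cnj (U j k)))"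
    by (rule sum.swap)
  also have "\<dots> = (\<Sum>k<N. complex_of_real (d k) * cnj (sesq N H (\<lambda>i. U i k) (\<lambda>i. U i k)))"
    by (simp add: sesq_def sum_distrib_left)
  finally show ?thesis .
qed

lemma sesq_eigenvector:
  assumes "diagonalizes N G U d" "k < N"
  shows "sesq N G (\<lambda>i. U i k) (\<lambda>i. U i k) = complex_of_real (d k)"
proof -
  have U: "unitary N U" using assms by (simp add: diagonalizes_def)
  have "sesq N G (\<lambda>i. U i k) (\<lambda>i. U i k) =
     (\<Sum>i<N. \<Sum>j<N. \<Sum>l<N. d l * (cnj (U i k) * U i l) * (cnj (U j l) * U j k))"
    unfolding sesq_def using assms
    by (intro sum.cong refl) (simp add: diagonalizes_def sum_distrib_left sum_distrib_right mult_ac)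
  also have "\<dots> = (\<Sum>i<N. \<Sum>l<N. \<Sum>j<N. d l * (cnj (U i k) * U i l) * (cnj (U j l) * U j k))"
    by (rule sum.cong[OF refl], rule sum.swap)
  also have "\<dots> = (\<Sum>l<N. \<Sum>i<N. \<Sum>j<N. d l * (cnj (U i k) * U i l) * (cnj (U j l) * U j k))"
    by (rule sum.swap)
  also have "\<dots> = (\<Sum>l<N. d l * (\<Sum>i<N. cnj (U i k) * U i l) * (\<Sum>j<N. cnj (U j l) * U j k))"
    by (simp add: sum_distrib_left sum_distrib_right mult_ac)
  also have "\<dots> = (\<Sum>l<N. if l = k then complex_of_real (d k) else 0)"
    using U assms(2) by (intro sum.cong refl) (auto simp: unitary_def)
  also have "\<dots> = complex_of_real (d k)" using assms(2) by (simp add: sum.delta)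
  finally show ?thesis .
qed

lemma hs_sq_diagonalized:
  assumes "diagonalizes N G U d"
  shows "hs_sq N G = (\<Sum>k<N. (d k)\<^sup>2)"
proof -
  have "complex_of_real (hs_sq N G) = (\<Sum>k<N. complex_of_real ((d k)\<^sup>2))"
    unfolding hs_sq_eq_hs_inner hs_inner_diagonalized[OF assms]
    by (intro sum.cong refl) (simp add: sesq_eigenvector[OF assms] power2_eq_square)
  thus ?thesis by (simp only: of_real_sum[symmetric] of_real_eq_iff)
qed

text \<open>Let \<open>N\<close> be the noise operator, \<open>I\<close> the average of \<open>|d|\<^sup>p\<close>, \<open>W\<close> the left-hand side, which is
  \<open>\<parallel>N G\<parallel>\<^sub>2\<^sup>2\<close> for the normalized trace, and \<open>H = N (N G)\<close>. Since \<open>N\<close> is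
  self-adjoint, \<open>W\<close> is the inner product of \<open>H\<close> and \<open>G\<close>, which only involves the eigenvalues \<open>d\<close> of \<open>G\<close> and the
  diagonal of \<open>H\<close> in the eigenbasis. Hoelder's inequality bounds it by \<open>I\<^sup>1\<^sup>-\<^sup>p\<^sup>/\<^sup>4 \<parallel>H\<parallel>\<^sub>4\<close>, and
  \<open>\<parallel>H\<parallel>\<^sub>4 \<le> \<parallel>N G\<parallel>\<^sub>2 = W\<^sup>1\<^sup>/\<^sup>2\<close> by \<open>bonami\<close>; it remains to divide by \<open>W\<^sup>1\<^sup>/\<^sup>2\<close> and to square.\<close>

lemma noise_contraction:
  assumes G: "diagonalizes (2 ^ n) G U d" and d: "\<And>k. k < 2 ^ n \<Longrightarrow> \<bar>d k\<bar> \<le> 1"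
    and p: "1 \<le> p" "p \<le> 2"
  shows "(\<Sum>s\<in>indices n. (cmod (complex_of_real ((1/5) ^ weight s) * fourier n G s))\<^sup>2)
    \<le> ((\<Sum>k<2^n. \<bar>d k\<bar> powr p) / 2 ^ n) powr (2 - p / 2)"
proof -
  define r where "r s = complex_of_real ((1/5) ^ weight s)" for s
  define W where "W = (\<Sum>s\<in>indices n. (cmod (r s * fourier n G s))\<^sup>2)"
  define H where "H = inv_fourier n (\<lambda>s. r s * (r s * fourier n G s))"
  define I where "I = (\<Sum>k<2^n. \<bar>d k\<bar> powr p) / 2 ^ n"
  define x where "x k = cmod (sesq (2 ^ n) H (\<lambda>i. U i k) (\<lambda>i. U i k))" for k
  have U: "unitary (2 ^ n) U" using G by (simp add: diagonalizes_def)
  have W0: "W \<ge> 0" by (simp add: W_def sum_nonneg)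
  have "schatten4_pow4 (2 ^ n) H \<le> 2 ^ n * W\<^sup>2"
    unfolding H_def W_def r_def by (rule bonami)
  hence X: "(\<Sum>k<2^n. x k ^ 4) / 2 ^ n \<le> W\<^sup>2"
    using sum_diagonal_power4_le_schatten4_pow4[OF U, of H] by (simp add: x_def field_simps)
  have "hs_inner (2 ^ n) H G = 2 ^ n * (\<Sum>s\<in>indices n. cnj (fourier n H s) * fourier n G s)" by (rule parseval)
  also have "(\<Sum>s\<in>indices n. cnj (fourier n H s) * fourier n G s) = (\<Sum>s\<in>indices n. (r s * fourier n G s) * cnj (r s * fourier n G s))"
    by (intro sum.cong refl) (simp add: H_def fourier_inv_fourier r_def mult_ac)
  also have "\<dots> = complex_of_real W"
    unfolding W_def of_real_sum complex_norm_square ..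
  finally have "complex_of_real (2 ^ n * W) = hs_inner (2 ^ n) H G" by simp
  hence "2 ^ n * W = cmod (hs_inner (2 ^ n) H G)" using W0 by (metis abs_of_nonneg norm_of_real mult_nonneg_nonneg zero_le_power zero_le_numeral)
  also have "\<dots> \<le> (\<Sum>k<2^n. cmod (complex_of_real (d k) * cnj (sesq (2 ^ n) H (\<lambda>i. U i k) (\<lambda>i. U i k))))"
    unfolding hs_inner_diagonalized[OF G] by (rule norm_sum)
  also have "\<dots> = (\<Sum>k<2^n. \<bar>d k\<bar> * x k)" by (simp add: x_def norm_mult)
  finally have "W \<le> (\<Sum>k<2^n. \<bar>d k\<bar> * x k) / 2 ^ n" by (simp add: field_simps)
  also have "\<dots> \<le> I powr (1 - p/4) * ((\<Sum>k<2^n. x k ^ 4) / 2 ^ n) powr (1/4)"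
    unfolding I_def using lessThan_empty_iff[of "2 ^ n"] hoelder_contraction[of "{..<2^n}" p "\<lambda>k. \<bar>d k\<bar>" x] p d by (simp add: x_def)
  also have "\<dots> \<le> I powr (1 - p/4) * (W\<^sup>2) powr (1/4)"
    by (intro mult_left_mono powr_mono2 X) (auto intro!: divide_nonneg_nonneg sum_nonneg simp: x_def)
  also have "(W\<^sup>2) powr (1/4) = sqrt W"
    using W0 by (cases "W = 0") (simp_all add: powr_powr powr_half_sqrt flip: powr_numeral)
  finally have le: "W \<le> I powr (1 - p/4) * sqrt W" .
  have "W \<le> (I powr (1 - p/4))\<^sup>2"
  proof (cases "W = 0")
    case False
    hence "sqrt W > 0" using W0 by simp
    moreover have "sqrt W * sqrt W \<le> I powr (1 - p/4) * sqrt W" using le W0 by simp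
    ultimately have "sqrt W \<le> I powr (1 - p/4)" by (metis mult_right_le_imp_le)
    thus ?thesis using W0 by (metis power_mono real_sqrt_ge_zero real_sqrt_pow2)
  qed simp
  also have "\<dots> = I powr (2 - p / 2)" by (simp add: power2_eq_square powr_add[symmetric])
  finally show ?thesis by (simp add: W_def I_def r_def)
qed

section \<open>Conditional expectation onto the complement of one factor\<close>

definition fun_block :: "nat \<Rightarrow> cmatrix \<Rightarrow> nat \<Rightarrow> nat \<Rightarrow> nat \<Rightarrow> nat \<Rightarrow> complex" where
  "fun_block N F a b = (\<lambda>x y. F (a * N + x) (b * N + y))"

text \<open>The map \<open>id \<otimes> \<dots> \<otimes> tr(\<cdot>)\<one> \<otimes> \<dots> \<otimes> id\<close> with \<open>j\<close> factors before the traced one and \<open>m\<close> factors after it, on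
  matrices of size \<open>2\<^sup>j\<^sup>+\<^sup>1\<^sup>+\<^sup>m\<close>. Counting the factors on both sides makes it structurally recursive: an
  identity factor in front means that the map acts on each of the four blocks.\<close>

primrec cond_exp :: "nat \<Rightarrow> nat \<Rightarrow> cmatrix \<Rightarrow> nat \<Rightarrow> nat \<Rightarrow> complex" where
  "cond_exp m 0 F = (\<lambda>x y. if x div 2 ^ m = y div 2 ^ m then component (2 ^ m) F 0 (x mod 2 ^ m) (y mod 2 ^ m) else 0)"
| "cond_exp m (Suc j) F = (\<lambda>x y. cond_exp m j (fun_block (2 ^ Suc (j + m)) F (x div 2 ^ Suc (j + m)) (y div 2 ^ Suc (j + m)))
      (x mod 2 ^ Suc (j + m)) (y mod 2 ^ Suc (j + m)))"

lemma cond_exp_linear: "cond_exp m j (\<lambda>x y. a * F x y + b * G x y) = (\<lambda>x y. a * cond_exp m j F x y + b * cond_exp m j G x y)"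
proof (induction j arbitrary: F G)
  case 0
  show ?case by (auto simp: fun_eq_iff component_def field_simps)
next
  case (Suc j)
  have "fun_block N (\<lambda>x y. a * F x y + b * G x y) u v = (\<lambda>x y. a * fun_block N F u v x y + b * fun_block N G u v x y)" for N u v
    by (simp add: fun_block_def)
  thus ?case by (simp add: Suc.IH)
qed

lemma cond_exp_cong:
  assumes "\<And>x y. x < 2 ^ Suc (j + m) \<Longrightarrow> y < 2 ^ Suc (j + m) \<Longrightarrow> F x y = G x y"
    and "x < 2 ^ Suc (j + m)" "y < 2 ^ Suc (j + m)"
  shows "cond_exp m j F x y = cond_exp m j G x y"
  using assms
proof (induction j arbitrary: F G x y)
  case 0
  have "k mod 2 ^ m < 2 ^ Suc m" "2 ^ m + k mod 2 ^ m < 2 ^ Suc m" for k :: nat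
    using mod_less_divisor[of "2 ^ m" k] zero_less_power[of "2::nat" m] unfolding power_Suc by linarith+
  thus ?case using 0 by (simp add: component_def)
next
  case (Suc j)
  define N :: nat where "N = 2 ^ Suc (j + m)"
  have N: "N > 0" by (simp add: N_def)
  have "x div N < 2" "y div N < 2"
    using Suc.prems(2,3) by (auto simp: N_def less_mult_imp_div_less)
  have less: "a * N + k < 2 ^ Suc (Suc j + m)" if "a < 2" "k < N" for a k
  proof -
    have "a * N + k < 1 * N + N" using that N by (intro add_le_less_mono mult_le_mono1) auto
    thus ?thesis by (simp add: N_def)
  qed
  have "cond_exp m j (fun_block N F (x div N) (y div N)) (x mod N) (y mod N) = cond_exp m j (fun_block N G (x div N) (y div N)) (x mod N) (y mod N)"
  proof (rule Suc.IH)
    fix k l :: nat assume "k < 2 ^ Suc (j + m)" "l < 2 ^ Suc (j + m)"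
    thus "fun_block N F (x div N) (y div N) k l = fun_block N G (x div N) (y div N) k l"
      unfolding fun_block_def using \<open>x div N < 2\<close> \<open>y div N < 2\<close>
      by (intro Suc.prems(1) less) (simp_all add: N_def)
  qed (use N in \<open>simp_all add: N_def\<close>)
  thus ?case by (simp add: N_def)
qed

lemma cnj_cond_exp: "cnj (cond_exp m j F x y) = cond_exp m j (\<lambda>x y. cnj (F y x)) y x"
proof (induction j arbitrary: F x y)
  case 0 show ?case by (auto simp: component_def)
next
  case (Suc j)
  show ?case by (simp add: Suc.IH fun_block_def)
qed

lemma cond_exp_Suc_component:
  assumes "x < 2 ^ Suc (j + m)" "y < 2 ^ Suc (j + m)"
  shows "component (2 ^ Suc (j + m)) (cond_exp m (Suc j) F) i x y = cond_exp m j (component (2 ^ Suc (j + m)) F i) x y"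
proof -
  define N :: nat where "N = 2 ^ Suc (j + m)"
  have xy: "x < N" "y < N" "N > 0" using assms by (simp_all add: N_def)
  have fun_block: "cond_exp m (Suc j) F x y = cond_exp m j (fun_block N F 0 0) x y" "cond_exp m (Suc j) F x (N + y) = cond_exp m j (fun_block N F 0 1) x y"
    "cond_exp m (Suc j) F (N + x) y = cond_exp m j (fun_block N F 1 0) x y" "cond_exp m (Suc j) F (N + x) (N + y) = cond_exp m j (fun_block N F 1 1) x y"
    using xy unfolding cond_exp.simps N_def[symmetric] by simp_all
  have c: "component N F i = (if i = 0 then (\<lambda>x y. (1/2) * fun_block N F 0 0 x y + (1/2) * fun_block N F 1 1 x y)
     else if i = 1 then (\<lambda>x y. (1/2) * fun_block N F 0 0 x y + (-1/2) * fun_block N F 1 1 x y)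
     else if i = 2 then (\<lambda>x y. (1 / complex_of_real (sqrt 2)) * fun_block N F 0 1 x y + 0 * fun_block N F 0 0 x y)
     else (\<lambda>x y. (1 / complex_of_real (sqrt 2)) * fun_block N F 1 0 x y + 0 * fun_block N F 0 0 x y))"
    by (simp add: component_def fun_block_def fun_eq_iff field_simps)
  show ?thesis
    unfolding N_def[symmetric] c
    by (simp only: if_distrib[of "cond_exp m j"] if_distribR cond_exp_linear split: if_split)
       (simp only: component_def fun_block, simp add: field_simps)
qed

lemma fourier_zero: "fourier n (\<lambda>x y. 0) s = 0"
  using fourier_scale[of n 0 "\<lambda>x y. 0" s] by simp

lemma fourier_cond_exp:
  "s \<in> indices (Suc (j + m)) \<Longrightarrow> fourier (Suc (j + m)) (cond_exp m j F) s = (if s ! j = 0 then fourier (Suc (j + m)) F s else 0)"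
proof (induction j arbitrary: F s)
  case 0
  then obtain i t where s: "s = i # t" "i < 4" by auto
  have "fourier m (component (2 ^ m) (cond_exp m 0 F) i) t = fourier m (if i = 0 then component (2 ^ m) F 0 else (\<lambda>x y. 0)) t"
    by (rule fourier_cong) (auto simp: component_def)
  thus ?case using s by (auto simp: fourier_zero)
next
  case (Suc j)
  from Suc.prems obtain i t where s: "s = i # t" "i < 4" "t \<in> indices (Suc (j + m))"
    unfolding add_Suc indices.simps(2)[of "Suc (j + m)"] by auto
  have "fourier (Suc (Suc j + m)) (cond_exp m (Suc j) F) s = fourier (Suc (j + m)) (component (2 ^ Suc (j + m)) (cond_exp m (Suc j) F) i) t"
    unfolding add_Suc fourier.simps(2)[of "Suc (j + m)"] s by simp
  also have "\<dots> = fourier (Suc (j + m)) (cond_exp m j (component (2 ^ Suc (j + m)) F i)) t"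
    by (rule fourier_cong, rule cond_exp_Suc_component)
  also have "\<dots> = (if t ! j = 0 then fourier (Suc (j + m)) (component (2 ^ Suc (j + m)) F i) t else 0)"
    by (rule Suc.IH[OF s(3)])
  also have "fourier (Suc (j + m)) (component (2 ^ Suc (j + m)) F i) t = fourier (Suc (Suc j + m)) F s"
    unfolding add_Suc fourier.simps(2)[of "Suc (j + m)"] s by simp
  finally show ?case by (simp only: s nth_Cons_Suc)
qed

lemma sesq_cong:
  assumes "\<And>x y. x < N \<Longrightarrow> y < N \<Longrightarrow> F x y = F' x y" "\<And>x. x < N \<Longrightarrow> v x = v' x" "\<And>x. x < N \<Longrightarrow> w x = w' x"
  shows "sesq N F v w = sesq N F' v' w'"
  unfolding sesq_def by (intro sum.cong refl) (simp add: assms)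

lemma sesq_double:
  "sesq (2 * N) F v w = sesq N (fun_block N F 0 0) v w + sesq N (fun_block N F 0 1) v (\<lambda>x. w (N + x))
    + sesq N (fun_block N F 1 0) (\<lambda>x. v (N + x)) w + sesq N (fun_block N F 1 1) (\<lambda>x. v (N + x)) (\<lambda>x. w (N + x))"
  unfolding sesq_def sum_lessThan_double fun_block_def by (simp add: sum.distrib add_ac)

lemma sesq_zero: "sesq N (\<lambda>x y. 0) v w = 0"
  by (simp add: sesq_def)

text \<open>A Kraus decomposition, recorded through the quadratic form: \<open>E F = \<Sum>\<^sub>i K\<^sub>i\<^sup>* F K\<^sub>i\<close> with four maps \<open>K\<^sub>i\<close>
  satisfying \<open>\<Sum>\<^sub>i K\<^sub>i\<^sup>* K\<^sub>i = \<one>\<close>. Two different vectors are needed in the first equation, since the off-diagonal blocks enter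
  the induction step; positivity of a map alone need not survive the tensor product with the identity.\<close>

lemma kraus_cond_exp:
  "\<exists>K. (\<forall>F v w. sesq (2 ^ Suc (j + m)) (cond_exp m j F) v w = (\<Sum>i<4. sesq (2 ^ Suc (j + m)) F (K i v) (K i w))) \<and>
     (\<forall>v. (\<Sum>i<4::nat. \<Sum>x<2 ^ Suc (j + m). (cmod (K i v x))\<^sup>2) = (\<Sum>x<2 ^ Suc (j + m). (cmod (v x))\<^sup>2))"
proof (induction j)
  case 0
  define N :: nat where "N = 2 ^ m"
  have N: "N > 0" by (simp add: N_def)
  \<comment> \<open>\<open>K i v\<close> picks one of the two halves of \<open>v\<close> and puts it, divided by \<open>\<surd>2\<close>, into one of two positions.\<close>
  define K :: "nat \<Rightarrow> (nat \<Rightarrow> complex) \<Rightarrow> nat \<Rightarrow> complex" where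
    "K i v = (\<lambda>x. if i = 0 then if x < N then v x / complex_of_real (sqrt 2) else 0
      else if i = 1 then if x < N then 0 else v (x - N) / complex_of_real (sqrt 2)
      else if i = 2 then if x < N then v (N + x) / complex_of_real (sqrt 2) else 0
      else if x < N then 0 else v x / complex_of_real (sqrt 2))" for i v
  have half: "complex_of_real (sqrt 2) * complex_of_real (sqrt 2) = 2"
    by (simp flip: of_real_mult)
  have "sesq (2 * N) (cond_exp m 0 F) v w = (\<Sum>i<4. sesq (2 * N) F (K i v) (K i w))" for F v w
  proof -
    have "sesq (2 * N) (cond_exp m 0 F) v w = sesq N (component N F 0) v w + sesq N (component N F 0) (\<lambda>x. v (N + x)) (\<lambda>x. w (N + x))"
    proof -
      have "sesq N (fun_block N (cond_exp m 0 F) 0 0) v w = sesq N (component N F 0) v w"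
        "sesq N (fun_block N (cond_exp m 0 F) 0 1) v (\<lambda>x. w (N + x)) = sesq N (\<lambda>x y. 0) v (\<lambda>x. w (N + x))"
        "sesq N (fun_block N (cond_exp m 0 F) 1 0) (\<lambda>x. v (N + x)) w = sesq N (\<lambda>x y. 0) (\<lambda>x. v (N + x)) w"
        "sesq N (fun_block N (cond_exp m 0 F) 1 1) (\<lambda>x. v (N + x)) (\<lambda>x. w (N + x)) = sesq N (component N F 0) (\<lambda>x. v (N + x)) (\<lambda>x. w (N + x))"
        using N by (intro sesq_cong refl; simp add: fun_block_def cond_exp.simps(1) N_def[symmetric])+
      thus ?thesis unfolding sesq_double by (simp add: sesq_zero)
    qed
    moreover have "sesq N (component N F 0) u z = sesq N (fun_block N F 0 0) u z / 2 + sesq N (fun_block N F 1 1) u z / 2" for u z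
      unfolding sesq_def sum_divide_distrib sum.distrib[symmetric]
      by (intro sum.cong refl) (simp add: component_def fun_block_def field_simps)
    moreover have "sesq (2 * N) F (K 0 v) (K 0 w) = sesq N (fun_block N F 0 0) v w / 2"
      unfolding sesq_def sum_lessThan_double K_def sum_divide_distrib fun_block_def by (simp add: half cong: sum.cong_simp)
    moreover have "sesq (2 * N) F (K 1 v) (K 1 w) = sesq N (fun_block N F 1 1) v w / 2"
      unfolding sesq_def sum_lessThan_double K_def sum_divide_distrib fun_block_def by (simp add: half cong: sum.cong_simp)
    moreover have "sesq (2 * N) F (K 2 v) (K 2 w) = sesq N (fun_block N F 0 0) (\<lambda>x. v (N + x)) (\<lambda>x. w (N + x)) / 2"
      unfolding sesq_def sum_lessThan_double K_def sum_divide_distrib fun_block_def by (simp add: half cong: sum.cong_simp)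
    moreover have "sesq (2 * N) F (K 3 v) (K 3 w) = sesq N (fun_block N F 1 1) (\<lambda>x. v (N + x)) (\<lambda>x. w (N + x)) / 2"
      unfolding sesq_def sum_lessThan_double K_def sum_divide_distrib fun_block_def by (simp add: half cong: sum.cong_simp)
    ultimately show ?thesis unfolding sum_lessThan_4 by (simp only: add.assoc)
  qed
  moreover have "(\<Sum>i<4::nat. \<Sum>x<2*N. (cmod (K i v x))\<^sup>2) = (\<Sum>x<2*N. (cmod (v x))\<^sup>2)" for v
  proof -
    have K_norms:
      "(\<Sum>x<2*N. (cmod (K 0 v x))\<^sup>2) = (\<Sum>x<N. (cmod (v x))\<^sup>2) / 2"
      "(\<Sum>x<2*N. (cmod (K 1 v x))\<^sup>2) = (\<Sum>x<N. (cmod (v x))\<^sup>2) / 2"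
      "(\<Sum>x<2*N. (cmod (K 2 v x))\<^sup>2) = (\<Sum>x<N. (cmod (v (N + x)))\<^sup>2) / 2"
      "(\<Sum>x<2*N. (cmod (K 3 v x))\<^sup>2) = (\<Sum>x<N. (cmod (v (N + x)))\<^sup>2) / 2"
      unfolding sum_lessThan_double K_def sum_divide_distrib
      by (simp_all add: norm_divide power_divide cong: sum.cong_simp)
    have "(\<Sum>x<2*N. (cmod (v x))\<^sup>2) = (\<Sum>x<N. (cmod (v x))\<^sup>2) + (\<Sum>x<N. (cmod (v (N + x)))\<^sup>2)"
      unfolding sum_lessThan_double sum.distrib ..
    thus ?thesis unfolding sum_lessThan_4 K_norms by simp
  qed
  ultimately show ?case unfolding N_def by (intro exI[of _ K]) simp
next
  case (Suc j)
  define N :: nat where "N = 2 ^ Suc (j + m)"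
  have N: "N > 0" by (simp add: N_def)
  from Suc.IH obtain K where K: "\<And>F v w. sesq N (cond_exp m j F) v w = (\<Sum>i<4::nat. sesq N F (K i v) (K i w))"
    "\<And>v. (\<Sum>i<4::nat. \<Sum>x<N. (cmod (K i v x))\<^sup>2) = (\<Sum>x<N. (cmod (v x))\<^sup>2)"
    unfolding N_def by blast
  \<comment> \<open>The Kraus maps act on both halves of the vector alike, i.e. as \<open>\<one> \<otimes> K i\<close>.\<close>
  define L where "L i v = (\<lambda>x. if x < N then K i v x else K i (\<lambda>x. v (N + x)) (x - N))" for i v
  have "sesq (2 * N) (cond_exp m (Suc j) F) v w = (\<Sum>i<4::nat. sesq (2 * N) F (L i v) (L i w))" for F v w
  proof -
    have "sesq N (fun_block N (cond_exp m (Suc j) F) a b) u z = (\<Sum>i<4::nat. sesq N (fun_block N F a b) (K i u) (K i z))" for a b u z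
    proof -
      have "sesq N (fun_block N (cond_exp m (Suc j) F) a b) u z = sesq N (cond_exp m j (fun_block N F a b)) u z"
        unfolding fun_block_def cond_exp.simps(2) N_def[symmetric] using N by (intro sesq_cong refl) simp
      thus ?thesis by (simp add: K)
    qed
    moreover have "sesq N G (L i v) z = sesq N G (K i v) z" "sesq N G z (L i v) = sesq N G z (K i v)" for G i v z
      by (intro sesq_cong refl; simp add: L_def)+
    moreover have "(\<lambda>x. L i v (N + x)) = K i (\<lambda>x. v (N + x))" for i v
      by (simp add: L_def)
    ultimately show ?thesis unfolding sesq_double by (simp add: sum.distrib)
  qed
  moreover have "(\<Sum>i<4::nat. \<Sum>x<2*N. (cmod (L i v x))\<^sup>2) = (\<Sum>x<2*N. (cmod (v x))\<^sup>2)" for v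
  proof -
    have "(\<Sum>x<2*N. (cmod (L i v x))\<^sup>2) = (\<Sum>x<N. (cmod (K i v x))\<^sup>2) + (\<Sum>x<N. (cmod (K i (\<lambda>x. v (N + x)) x))\<^sup>2)" for i
      unfolding sum_lessThan_double sum.distrib by (simp add: L_def cong: sum.cong_simp)
    thus ?thesis by (simp add: sum.distrib K sum_lessThan_double)
  qed
  ultimately show ?case unfolding N_def by (intro exI[of _ L]) simp
qed

definition deriv_fun :: "nat \<Rightarrow> nat \<Rightarrow> cmatrix \<Rightarrow> nat \<Rightarrow> nat \<Rightarrow> complex" where
  "deriv_fun m j F = (\<lambda>x y. F x y - cond_exp m j F x y)"

lemma fourier_deriv_fun:
  "s \<in> indices (Suc (j + m)) \<Longrightarrow> fourier (Suc (j + m)) (deriv_fun m j F) s = (if s ! j = 0 then 0 else fourier (Suc (j + m)) F s)"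
  using fourier_add[of "Suc (j + m)" F "\<lambda>x y. (-1) * cond_exp m j F x y" s] fourier_scale[of "Suc (j + m)" "-1" "cond_exp m j F" s]
    fourier_cond_exp[of s j m F]
  by (simp add: deriv_fun_def del: fourier.simps)

text \<open>Both \<open>F\<close> and its conditional expectation lie between 0 and \<open>\<one>\<close>, so their difference lies between \<open>-\<one>\<close> and \<open>\<one>\<close>.\<close>

lemma sesq_deriv_fun_bounds:
  assumes F: "\<And>v. 0 \<le> Re (sesq (2 ^ Suc (j + m)) F v v)"
    "\<And>v. Re (sesq (2 ^ Suc (j + m)) F v v) \<le> (\<Sum>x<2 ^ Suc (j + m). (cmod (v x))\<^sup>2)"
  shows "\<bar>Re (sesq (2 ^ Suc (j + m)) (deriv_fun m j F) v v)\<bar> \<le> (\<Sum>x<2 ^ Suc (j + m). (cmod (v x))\<^sup>2)"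
proof -
  let ?N = "2 ^ Suc (j + m)"
  from kraus_cond_exp[of j m] obtain K where K: "\<And>F v w. sesq ?N (cond_exp m j F) v w = (\<Sum>i<4::nat. sesq ?N F (K i v) (K i w))"
    "\<And>v. (\<Sum>i<4::nat. \<Sum>x<?N. (cmod (K i v x))\<^sup>2) = (\<Sum>x<?N. (cmod (v x))\<^sup>2)" by blast
  have "sesq ?N (deriv_fun m j F) v v = sesq ?N F v v - sesq ?N (cond_exp m j F) v v"
    by (simp add: deriv_fun_def sesq_def algebra_simps sum_subtractf del: power_Suc)
  moreover have "0 \<le> Re (sesq ?N (cond_exp m j F) v v)"
    unfolding K Re_sum by (intro sum_nonneg F)
  moreover have "Re (sesq ?N (cond_exp m j F) v v) \<le> (\<Sum>i<4::nat. \<Sum>x<?N. (cmod (K i v x))\<^sup>2)"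
    unfolding K(1) Re_sum by (intro sum_mono F)
  ultimately show ?thesis using F[of v] unfolding K(2) by (simp del: power_Suc)
qed

section \<open>From the Fourier side to the exponential bound\<close>

lemma weight_eq_card: "s \<in> indices n \<Longrightarrow> weight s = card {j. j < n \<and> s ! j \<noteq> 0}"
  by (simp add: weight_def length_filter_conv_card length_indices)

text \<open>With \<open>c = 2 ln 5\<close> the exponential on the right is \<open>e\<^sup>x\<close> for \<open>x = L - c w\<close>, and
  \<open>L = c w + x \<le> c w + e\<^sup>x \<le> (1 + c) (w + w e\<^sup>x)\<close>.\<close>

lemma log_le_weight:
  assumes "w \<ge> 1"
  shows "L \<le> (1 + 2 * ln 5) * (real w * (1 + exp L * ((1/5) ^ w)\<^sup>2))"
proof -
  have r: "((1/5) ^ w)\<^sup>2 = exp (- (2 * ln 5 * real w))"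
  proof -
    have "((1/5 :: real) ^ w)\<^sup>2 = exp (- ln 5) ^ (w * 2)"
      by (simp add: exp_minus power_mult inverse_eq_divide)
    also have "\<dots> = exp (real (w * 2) * - ln 5)" by (rule exp_of_nat_mult[symmetric])
    finally show ?thesis by (simp add: mult_ac)
  qed
  let ?x = "L - 2 * ln 5 * real w"
  have l5: "ln 5 > (0::real)" by simp
  have w1: "real w \<ge> 1" using assms by simp
  have "?x \<le> exp ?x" using exp_ge_add_one_self[of ?x] by linarith
  also have "\<dots> \<le> real w * exp ?x" using w1 by simp
  also have "\<dots> \<le> (1 + 2 * ln 5) * (real w * exp ?x)"
    using mult_right_mono[of 1 "1 + 2 * ln 5" "real w * exp ?x"] l5 by simp
  finally have "L \<le> 2 * ln 5 * real w + (1 + 2 * ln 5) * (real w * exp ?x)" by simp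
  also have "\<dots> \<le> (1 + 2 * ln 5) * real w + (1 + 2 * ln 5) * (real w * exp ?x)"
    by (simp add: algebra_simps)
  also have "\<dots> = (1 + 2 * ln 5) * (real w * (1 + exp L * ((1/5) ^ w)\<^sup>2))"
  proof -
    have "exp ?x = exp L * ((1/5) ^ w)\<^sup>2" unfolding r by (simp flip: exp_add)
    thus ?thesis by (simp only: distrib_left mult_1_right)
  qed
  finally show ?thesis .
qed

text \<open>The purely scalar end of the argument. The matrices \<open>D j\<close> play the role of the derivatives; the hypothesis on their Fourier
  coefficients is the only link between them, and \<open>V\<close> is the variance of the matrix with coefficients \<open>c\<close>.\<close>

lemma influence_inequality:
  fixes D :: "nat \<Rightarrow> nat \<Rightarrow> nat \<Rightarrow> complex" and d :: "nat \<Rightarrow> nat \<Rightarrow> real"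
  assumes p: "1 \<le> p" "p < 2"
    and fourier_D: "\<And>j s. j < n \<Longrightarrow> s \<in> indices n \<Longrightarrow> fourier n (D j) s = (if s ! j = 0 then 0 else c s)"
    and diag: "\<And>j. j < n \<Longrightarrow> diagonalizes (2 ^ n) (D j) (U j) (d j)"
    and d1: "\<And>j k. j < n \<Longrightarrow> k < 2 ^ n \<Longrightarrow> \<bar>d j k\<bar> \<le> 1"
  defines "I j \<equiv> (\<Sum>k<2^n. \<bar>d j k\<bar> powr p) / 2 ^ n"
    and "V \<equiv> (\<Sum>s\<in>indices n. if weight s = 0 then 0 else (cmod (c s))\<^sup>2)"
  assumes V: "V > 0"
  shows "exp (- ((4 + 8 * ln 5) / (2 - p)) * ((\<Sum>j<n. I j) / V)) \<le> Max (I ` {..<n})"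
proof -
  define A where "A j = (\<Sum>s\<in>indices n. (cmod (fourier n (D j) s))\<^sup>2)" for j
  define B where "B j = (\<Sum>s\<in>indices n. (cmod (complex_of_real ((1/5) ^ weight s) * fourier n (D j) s))\<^sup>2)" for j
  define M where "M = Max (I ` {..<n})"
  define C :: real where "C = 1 + 2 * ln 5"
  define \<alpha> where "\<alpha> = 1 - p / 2"
  have \<alpha>: "\<alpha> > 0" using p by (simp add: \<alpha>_def)
  have C: "C > 0" unfolding C_def by (simp add: add_pos_pos)
  have I0: "I j \<ge> 0" for j by (simp add: I_def sum_nonneg)
  have IM: "I j \<le> M" if "j < n" for j using that by (simp add: M_def)
  have A: "A j \<le> I j" if j: "j < n" for j
  proof -
    have "2 ^ n * A j = (\<Sum>k<2^n. (d j k)\<^sup>2)"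
      using parseval_hs_sq[of n "D j"] hs_sq_diagonalized[OF diag[OF j]] by (simp add: A_def)
    also have "\<dots> \<le> (\<Sum>k<2^n. \<bar>d j k\<bar> powr p)"
    proof (intro sum_mono)
      fix k :: nat assume "k \<in> {..<2^n}"
      hence "\<bar>d j k\<bar> \<le> 1" using d1[OF j] by simp
      have "(d j k)\<^sup>2 = \<bar>d j k\<bar> powr 2" by (cases "d j k = 0") simp_all
      also have "\<dots> \<le> \<bar>d j k\<bar> powr p"
        by (rule powr_mono') (use p \<open>\<bar>d j k\<bar> \<le> 1\<close> in auto)
      finally show "(d j k)\<^sup>2 \<le> \<bar>d j k\<bar> powr p" .
    qed
    finally show ?thesis by (simp add: I_def field_simps)
  qed
  have B: "B j \<le> I j powr (2 - p / 2)" if j: "j < n" for j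
    unfolding B_def I_def using p by (intro noise_contraction[OF diag[OF j]] d1 j) auto
  have A0: "A j \<ge> 0" for j by (simp add: A_def sum_nonneg)
  \<comment> \<open>If every influence vanished, so would all non-constant coefficients.\<close>
  have Mpos: "M > 0"
  proof (rule ccontr)
    assume "\<not> M > 0"
    have "cmod (c s) = 0" if s: "s \<in> indices n" "weight s \<noteq> 0" for s
    proof -
      obtain j where j: "j < n" "s ! j \<noteq> 0"
        using s by (auto simp: weight_eq_card[OF s(1)] card_gt_0_iff)
      have "A j = 0" using A[OF j(1)] A0[of j] IM[OF j(1)] \<open>\<not> M > 0\<close> by linarith
      hence "(cmod (fourier n (D j) s))\<^sup>2 = 0"
        unfolding A_def using s(1) by (subst (asm) sum_nonneg_eq_0_iff) auto
      thus ?thesis using fourier_D[OF j(1) s(1)] j(2) by simp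
    qed
    hence "V = 0" unfolding V_def by (intro sum.neutral) auto
    thus False using V by simp
  qed
  \<comment> \<open>This choice balances the two terms: \<open>exp L * M powr \<alpha> = 1\<close>.\<close>
  define L where "L = - \<alpha> * ln M"
  have eL: "exp L = M powr (- \<alpha>)" using Mpos by (simp add: L_def powr_def)
  have eB: "exp L * B j \<le> I j" if j: "j < n" for j
  proof -
    have "exp L * B j \<le> M powr (- \<alpha>) * I j powr (1 + \<alpha>)"
      unfolding eL using B[OF j] by (intro mult_left_mono) (auto simp: \<alpha>_def)
    also have "\<dots> = (M powr (- \<alpha>) * I j powr \<alpha>) * I j"
      using I0[of j] by (cases "I j = 0") (simp_all add: powr_add)
    also have "\<dots> \<le> (M powr (- \<alpha>) * M powr \<alpha>) * I j"
      using I0 IM[OF j] \<alpha> by (intro mult_right_mono mult_left_mono powr_mono2) auto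
    also have "\<dots> = I j" using Mpos by (simp flip: powr_add)
    finally show ?thesis .
  qed
  have "L * V = (\<Sum>s\<in>indices n. if weight s = 0 then 0 else L * (cmod (c s))\<^sup>2)"
    unfolding V_def sum_distrib_left by (intro sum.cong) auto
  also have "\<dots> \<le> (\<Sum>s\<in>indices n. \<Sum>j<n. C * ((cmod (fourier n (D j) s))\<^sup>2
      + exp L * (cmod (complex_of_real ((1/5) ^ weight s) * fourier n (D j) s))\<^sup>2))"
  proof (intro sum_mono)
    fix s assume s: "s \<in> indices n"
    let ?e = "1 + exp L * ((1/5) ^ weight s)\<^sup>2"
    have "(\<Sum>j<n. C * ((cmod (fourier n (D j) s))\<^sup>2
       + exp L * (cmod (complex_of_real ((1/5) ^ weight s) * fourier n (D j) s))\<^sup>2))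
      = (\<Sum>j<n. if s ! j \<noteq> 0 then C * ?e * (cmod (c s))\<^sup>2 else 0)"
      using s by (intro sum.cong refl)
        (simp add: fourier_D norm_mult norm_power power_mult_distrib norm_divide power_divide algebra_simps)
    also have "\<dots> = real (weight s) * (C * ?e * (cmod (c s))\<^sup>2)"
    proof -
      have "(\<Sum>j<n. if s ! j \<noteq> 0 then C * ?e * (cmod (c s))\<^sup>2 else 0)
        = (\<Sum>j\<in>{j. j < n \<and> s ! j \<noteq> 0}. C * ?e * (cmod (c s))\<^sup>2)"
        by (intro sum.mono_neutral_cong_right) auto
      thus ?thesis by (simp add: weight_eq_card[OF s])
    qed
    finally have eq: "(\<Sum>j<n. C * ((cmod (fourier n (D j) s))\<^sup>2
       + exp L * (cmod (complex_of_real ((1/5) ^ weight s) * fourier n (D j) s))\<^sup>2))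
      = (C * (real (weight s) * ?e)) * (cmod (c s))\<^sup>2" by (simp add: mult_ac)
    show "(if weight s = 0 then 0 else L * (cmod (c s))\<^sup>2) \<le> (\<Sum>j<n. C * ((cmod (fourier n (D j) s))\<^sup>2
       + exp L * (cmod (complex_of_real ((1/5) ^ weight s) * fourier n (D j) s))\<^sup>2))"
    proof (cases "weight s = 0")
      case False
      hence "L \<le> C * (real (weight s) * ?e)"
        unfolding C_def by (intro log_le_weight) simp
      thus ?thesis unfolding eq using False by (simp add: mult_right_mono)
    qed (unfold eq, simp)
  qed
  also have "\<dots> = (\<Sum>j<n. C * (A j + exp L * B j))"
    unfolding A_def B_def
    by (subst sum.swap) (simp only: sum_distrib_left[symmetric] sum.distrib)
  also have "\<dots> \<le> (\<Sum>j<n. C * (I j + I j))"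
    using C A eB by (intro sum_mono mult_left_mono add_mono) auto
  also have "\<dots> = 2 * C * (\<Sum>j<n. I j)"
    by (simp add: sum_distrib_left algebra_simps)
  finally have "L \<le> 2 * C * (\<Sum>j<n. I j) / V" using V by (simp add: field_simps)
  hence "- ln M * \<alpha> \<le> 2 * C * (\<Sum>j<n. I j) / V"
    by (simp add: L_def mult.commute)
  hence "- ln M \<le> 2 * C * (\<Sum>j<n. I j) / V / \<alpha>"
    by (simp only: pos_le_divide_eq[OF \<alpha>])
  also have "\<dots> = (4 + 8 * ln 5) / (2 - p) * ((\<Sum>j<n. I j) / V)"
    using p V by (simp add: C_def \<alpha>_def field_simps)
  finally have "exp (- ((4 + 8 * ln 5) / (2 - p)) * ((\<Sum>j<n. I j) / V)) \<le> exp (ln M)"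
    by simp
  also have "exp (ln M) = M" using Mpos by simp
  finally show ?thesis unfolding M_def .
qed

section \<open>Unitary diagonalization of Hermitian matrices\<close>

lemma dim_mat_adjoint [simp]:
  "dim_row (mat_adjoint A) = dim_col A" "dim_col (mat_adjoint A) = dim_row A"
  by (simp_all add: mat_adjoint_def)

lemma mat_adjoint_carrier [simp]: "A \<in> carrier_mat n m \<Longrightarrow> mat_adjoint A \<in> carrier_mat m n"
  by auto

lemma mat_adjoint_index [simp]:
  "i < dim_col A \<Longrightarrow> j < dim_row A \<Longrightarrow> mat_adjoint (A :: complex mat) $$ (i, j) = cnj (A $$ (j, i))"
  by (simp add: mat_adjoint_def mat_of_rows_index)

lemma mat_adjoint_mult:
  assumes "A \<in> carrier_mat n m" "(B :: complex mat) \<in> carrier_mat m l"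
  shows "mat_adjoint (A * B) = mat_adjoint B * mat_adjoint A"
  using assms by (intro eq_matI) (auto simp: scalar_prod_def mult.commute intro!: sum.cong)

lemma mat_adjoint_adjoint: "mat_adjoint (mat_adjoint A) = (A :: complex mat)"
  by (rule eq_matI) auto

lemma complex_eigenvector_exists:
  assumes A: "(A :: complex mat) \<in> carrier_mat n n" and n: "n > 0"
  obtains e v where "v \<in> carrier_vec n" "v \<noteq> 0\<^sub>v n" "A *\<^sub>v v = e \<cdot>\<^sub>v v"
proof -
  from degree_monic_char_poly[OF A] n have "degree (char_poly A) \<noteq> 0" by auto
  hence "\<not> constant (poly (char_poly A))" by (simp add: constant_degree)
  then obtain e where "poly (char_poly A) e = 0"
    using fundamental_theorem_of_algebra by blast
  hence "eigenvalue A e" using eigenvalue_root_char_poly[OF A] by simp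
  thus ?thesis
    using that A unfolding eigenvalue_def eigenvector_def by auto
qed

text \<open>Gram--Schmidt gives an orthogonal basis that starts with \<open>v\<close>; the columns are then normalized.\<close>

lemma unitary_with_first_column:
  assumes v: "(v :: complex vec) \<in> carrier_vec n" and v0: "v \<noteq> 0\<^sub>v n" and n: "n > 0"
  obtains W c where "W \<in> carrier_mat n n" "mat_adjoint W * W = 1\<^sub>m n" "W * mat_adjoint W = 1\<^sub>m n"
    "col W 0 = c \<cdot>\<^sub>v v"
proof -
  interpret cof_vec_space n "TYPE(complex)" .
  define b where "b = basis_completion v"
  define ws where "ws = gram_schmidt n b"
  from basis_completion[OF v v0, folded b_def]
  have dist_b: "distinct b" and indep: "\<not> lin_dep (set b)" and b: "set b \<subseteq> carrier_vec n"
    and hdb: "hd b = v" and len_b: "length b = n" by auto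
  from hdb len_b n obtain vs where bv: "b = v # vs" by (cases b, auto)
  from gram_schmidt_result[OF b dist_b indep refl, folded ws_def]
  have ws: "set ws \<subseteq> carrier_vec n" "corthogonal ws" "length ws = n"
    by (auto simp: len_b)
  from gram_schmidt_hd[OF v, of vs, folded bv] have "hd ws = v" unfolding ws_def .
  hence ws0: "ws ! 0 = v" using ws n by (metis hd_conv_nth length_greater_0_conv)
  have wsi: "ws ! i \<in> carrier_vec n" if "i < n" for i using ws that by auto
  define q where "q i = sqrt (Re (ws ! i \<bullet>c ws ! i))" for i
  have pos: "Re (ws ! i \<bullet>c ws ! i) > 0 \<and> Im (ws ! i \<bullet>c ws ! i) = 0" if "i < n" for i
  proof -
    have "ws ! i \<bullet>c ws ! i \<noteq> 0" using corthogonalD[OF ws(2), of i i] that ws by auto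
    moreover have "0 \<le> ws ! i \<bullet>c ws ! i" by (rule conjugate_square_ge_0_vec)
    ultimately show ?thesis by (simp add: less_eq_complex_def complex_eq_iff)
  qed
  have q: "complex_of_real (q i) * complex_of_real (q i) = ws ! i \<bullet>c ws ! i" "q i > 0" if "i < n" for i
    using pos[OF that] by (auto simp: q_def complex_eq_iff real_sqrt_mult_self)
  define W where "W = mat n n (\<lambda>(i, j). ws ! j $ i / complex_of_real (q j))"
  have W: "W \<in> carrier_mat n n" by (simp add: W_def)
  have Wi: "mat_adjoint W $$ (i, j) = cnj (ws ! i $ j) / complex_of_real (q i)" if "i < n" "j < n" for i j
    using that by (simp add: W_def)
  have WW: "mat_adjoint W * W = 1\<^sub>m n"
  proof (rule eq_matI)
    fix i j assume "i < dim_row (1\<^sub>m n :: complex mat)" "j < dim_col (1\<^sub>m n :: complex mat)"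
    hence ij: "i < n" "j < n" by auto
    have "(mat_adjoint W * W) $$ (i, j) = (\<Sum>k<n. mat_adjoint W $$ (i, k) * W $$ (k, j))"
      using ij W mat_adjoint_carrier[OF W] by (auto simp: scalar_prod_def lessThan_atLeast0 intro!: sum.cong)
    also have "\<dots> = (\<Sum>k<n. ws ! j $ k * cnj (ws ! i $ k)) / (complex_of_real (q i) * complex_of_real (q j))"
      unfolding sum_divide_distrib using ij by (intro sum.cong refl) (simp add: Wi W_def)
    also have "(\<Sum>k<n. ws ! j $ k * cnj (ws ! i $ k)) = ws ! j \<bullet>c ws ! i"
      using wsi[OF ij(1)] wsi[OF ij(2)] by (auto simp: scalar_prod_def lessThan_atLeast0 intro!: sum.cong)
    also have "\<dots> / (complex_of_real (q i) * complex_of_real (q j)) = (if i = j then 1 else 0)"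
      using corthogonalD[OF ws(2), of j i] ij ws(3) q[OF ij(1)] by auto
    finally show "(mat_adjoint W * W) $$ (i, j) = 1\<^sub>m n $$ (i, j)" using ij by simp
  qed (use W mat_adjoint_carrier[OF W] in auto)
  have "W * mat_adjoint W = 1\<^sub>m n"
    by (rule mat_mult_left_right_inverse[OF mat_adjoint_carrier[OF W] W WW])
  moreover have "col W 0 = (1 / complex_of_real (q 0)) \<cdot>\<^sub>v v"
    using n v by (intro eq_vecI) (auto simp: W_def ws0)
  ultimately show ?thesis using that W WW by blast
qed

text \<open>In an orthonormal basis that starts with an eigenvector, the first column of a Hermitian matrix is a multiple of the first unit
  vector, and so is the first row by symmetry. What remains is a Hermitian matrix of smaller size.\<close>

lemma hermitian_diagonalizable:
  assumes "(A :: complex mat) \<in> carrier_mat n n" "mat_adjoint A = A"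
  shows "\<exists>U d. similar_mat_wit A (mat_diag n (\<lambda>i. complex_of_real (d i))) U (mat_adjoint U)"
  using assms
proof (induction n arbitrary: A)
  case 0
  have "similar_mat_wit A (mat_diag 0 (\<lambda>i. complex_of_real 0)) (1\<^sub>m 0) (mat_adjoint (1\<^sub>m 0))"
    using 0 mat_adjoint_carrier[of "1\<^sub>m 0 :: complex mat" 0 0]
    by (intro similar_mat_witI[of _ _ 0]) (auto intro!: eq_matI)
  thus ?case by (rule exI[of _ "\<lambda>_. 0", THEN exI[of _ "1\<^sub>m 0"]])
next
  case (Suc n)
  note A = Suc.prems(1)
  obtain e v where v: "v \<in> carrier_vec (Suc n)" "v \<noteq> 0\<^sub>v (Suc n)" and ev: "A *\<^sub>v v = e \<cdot>\<^sub>v v"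
    by (rule complex_eigenvector_exists[OF A zero_less_Suc])
  obtain W c where W: "W \<in> carrier_mat (Suc n) (Suc n)" and WW: "mat_adjoint W * W = 1\<^sub>m (Suc n)" "W * mat_adjoint W = 1\<^sub>m (Suc n)"
    and W0: "col W 0 = c \<cdot>\<^sub>v v"
    by (rule unitary_with_first_column[OF v zero_less_Suc])
  note W' = mat_adjoint_carrier[OF W]
  define B where "B = mat_adjoint W * A * W"
  have B: "B \<in> carrier_mat (Suc n) (Suc n)" using A W W' by (auto simp: B_def)
  have "mat_adjoint B = mat_adjoint W * mat_adjoint (mat_adjoint W * A)"
    unfolding B_def by (rule mat_adjoint_mult) (use A W W' in auto)
  also have "mat_adjoint (mat_adjoint W * A) = A * W"
    using mat_adjoint_mult[OF W' A] by (simp add: mat_adjoint_adjoint Suc.prems(2))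
  finally have hB: "mat_adjoint B = B"
    using A W W' by (simp add: B_def assoc_mult_mat[of _ "Suc n" "Suc n" _ "Suc n" _ "Suc n"])
  have "col (A * W) 0 = e \<cdot>\<^sub>v col W 0"
  proof -
    have "col (A * W) 0 = A *\<^sub>v (c \<cdot>\<^sub>v v)"
      using col_mult2[OF A W zero_less_Suc] unfolding W0 .
    also have "\<dots> = c \<cdot>\<^sub>v (A *\<^sub>v v)" using A v by (simp add: mult_mat_vec)
    also have "\<dots> = e \<cdot>\<^sub>v (c \<cdot>\<^sub>v v)" unfolding ev by (simp add: smult_smult_assoc mult.commute)
    finally show ?thesis by (simp add: W0)
  qed
  have col0: "B $$ (i, 0) = (if i = 0 then e else 0)" if "i < Suc n" for i
  proof -
    have "B $$ (i, 0) = (mat_adjoint W * (A * W)) $$ (i, 0)"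
      using A W W' by (simp add: B_def assoc_mult_mat[of _ "Suc n" "Suc n" _ "Suc n" _ "Suc n"])
    also have "\<dots> = row (mat_adjoint W) i \<bullet> col (A * W) 0" using that A W W' by auto
    also have "\<dots> = e * (row (mat_adjoint W) i \<bullet> col W 0)"
      using \<open>col (A * W) 0 = e \<cdot>\<^sub>v col W 0\<close> W W' that by (auto intro!: scalar_prod_smult_right)
    also have "row (mat_adjoint W) i \<bullet> col W 0 = (mat_adjoint W * W) $$ (i, 0)" using that W W' by auto
    finally show ?thesis using that by (simp add: WW)
  qed
  have row0: "B $$ (0, i) = (if i = 0 then e else 0)" if "i < Suc n" for i
  proof -
    have "B $$ (0, i) = cnj (B $$ (i, 0))"
      using B mat_adjoint_index[of 0 B i] that by (simp add: hB)
    moreover have "e = cnj e"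
      using B mat_adjoint_index[of 0 B 0] col0[of 0] by (simp add: hB)
    ultimately show ?thesis using col0[OF that] by simp
  qed
  have e_real: "e = complex_of_real (Re e)"
    using B mat_adjoint_index[of 0 B 0] col0[of 0] by (simp add: hB complex_eq_iff)
  define C where "C = mat n n (\<lambda>(i, j). B $$ (Suc i, Suc j))"
  have C: "C \<in> carrier_mat n n" by (simp add: C_def)
  have hC: "mat_adjoint C = C"
  proof (rule eq_matI)
    fix i j assume "i < dim_row C" "j < dim_col C"
    hence ij: "i < n" "j < n" using C by auto
    have "cnj (B $$ (Suc j, Suc i)) = B $$ (Suc i, Suc j)"
      using B mat_adjoint_index[of "Suc i" B "Suc j"] ij by (simp add: hB)
    thus "mat_adjoint C $$ (i, j) = C $$ (i, j)"
      using ij by (simp add: C_def)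
  qed (use C mat_adjoint_carrier[OF C] in auto)
  from Suc.IH[OF C hC] obtain V d where V: "similar_mat_wit C (mat_diag n (\<lambda>i. complex_of_real (d i))) V (mat_adjoint V)" by blast
  note v = similar_mat_witD2[OF C V]
  let ?fb = "\<lambda>X. four_block_mat (1\<^sub>m 1) (0\<^sub>m 1 n) (0\<^sub>m n 1) X :: complex mat"
  let ?E = "mat 1 1 (\<lambda>_. e)"
  define d' where "d' i = (if i = 0 then Re e else d (i - 1))" for i
  have Bblock: "B = four_block_mat ?E (0\<^sub>m 1 n) (0\<^sub>m n 1) C"
    by (rule eq_matI) (use B in \<open>auto simp: col0 row0 C_def\<close>)
  have Dblock: "mat_diag (Suc n) (\<lambda>i. complex_of_real (d' i)) = four_block_mat ?E (0\<^sub>m 1 n) (0\<^sub>m n 1) (mat_diag n (\<lambda>i. complex_of_real (d i)))"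
    by (rule eq_matI) (use e_real in \<open>auto simp: mat_diag_def d'_def\<close>)
  have fbV: "?fb V \<in> carrier_mat (Suc n) (Suc n)" using v by auto
  have adj_fb: "mat_adjoint (?fb V) = ?fb (mat_adjoint V)"
    by (rule eq_matI)
       (use v in auto)
  have "similar_mat_wit B (mat_diag (Suc n) (\<lambda>i. complex_of_real (d' i))) (?fb V) (?fb (mat_adjoint V))"
    unfolding Bblock Dblock
    by (rule similar_mat_wit_four_block[OF similar_mat_wit_refl V]) (use v C in auto)
  moreover have "similar_mat_wit A B W (mat_adjoint W)"
  proof (rule similar_mat_witI[of _ _ "Suc n"])
    have "W * B * mat_adjoint W = (W * mat_adjoint W) * A * (W * mat_adjoint W)"
      unfolding B_def using A W W' by (simp add: assoc_mult_mat[of _ "Suc n" "Suc n" _ "Suc n" _ "Suc n"] mult_carrier_mat[of _ "Suc n" "Suc n" _ "Suc n"])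
    thus "A = W * B * mat_adjoint W" using A WW by simp
  qed (use A B W W' WW in auto)
  ultimately have "similar_mat_wit A (mat_diag (Suc n) (\<lambda>i. complex_of_real (d' i))) (W * ?fb V) (?fb (mat_adjoint V) * mat_adjoint W)"
    by (rule similar_mat_wit_trans[rotated])
  moreover have "?fb (mat_adjoint V) * mat_adjoint W = mat_adjoint (W * ?fb V)"
    using mat_adjoint_mult[OF W fbV] by (simp only: adj_fb)
  ultimately show ?case by metis
qed

section \<open>Tensor products of maps in coordinates\<close>

definition entries :: "complex mat \<Rightarrow> nat \<Rightarrow> nat \<Rightarrow> complex" where
  "entries T = (\<lambda>i j. T $$ (i, j))"

lemma matrix_unit_index [simp]:
  "k < N \<Longrightarrow> l < N \<Longrightarrow> matrix_unit N i j $$ (k, l) = (if k = i \<and> l = j then 1 else 0)"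
  "matrix_unit N i j \<in> carrier_mat N N"
  by (auto simp: matrix_unit_def)

text \<open>Linearity in the form that \<open>tensor_map\<close> uses, where only the values on matrix units enter.\<close>

definition kernel_linear :: "nat \<Rightarrow> (complex mat \<Rightarrow> complex mat) \<Rightarrow> bool" where
  "kernel_linear N \<Psi> \<longleftrightarrow> (\<forall>T\<in>carrier_mat N N. \<Psi> T \<in> carrier_mat N N \<and>
     (\<forall>x<N. \<forall>y<N. \<Psi> T $$ (x, y) = (\<Sum>k<N. \<Sum>l<N. T $$ (k, l) * \<Psi> (matrix_unit N k l) $$ (x, y))))"

lemma kernel_linearD:
  assumes "kernel_linear N \<Psi>" "T \<in> carrier_mat N N"
  shows "\<Psi> T \<in> carrier_mat N N"
    and "x < N \<Longrightarrow> y < N \<Longrightarrow> \<Psi> T $$ (x, y) = (\<Sum>k<N. \<Sum>l<N. T $$ (k, l) * \<Psi> (matrix_unit N k l) $$ (x, y))"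
  using assms unfolding kernel_linear_def by blast+

lemma sum_delta2:
  fixes f :: "nat \<Rightarrow> nat \<Rightarrow> complex"
  assumes "a < N" "b < M"
  shows "(\<Sum>k<N. \<Sum>l<M. (if k = a \<and> l = b then 1 else 0) * f k l) = f a b"
    and "(\<Sum>k<N. \<Sum>l<M. f k l * (if a = k \<and> b = l then 1 else 0)) = f a b"
proof -
  have "(\<Sum>k<N. \<Sum>l<M. (if k = a \<and> l = b then 1 else 0) * f k l) = (\<Sum>k<N. if k = a then f a b else 0)"
    using assms by (intro sum.cong refl) (auto simp: sum.delta if_distrib[of "\<lambda>z. z * _"] cong: if_cong)
  thus "(\<Sum>k<N. \<Sum>l<M. (if k = a \<and> l = b then 1 else 0) * f k l) = f a b" using assms by simp
  have "(\<Sum>k<N. \<Sum>l<M. f k l * (if a = k \<and> b = l then 1 else 0)) = (\<Sum>k<N. if a = k then f a b else 0)"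
    using assms by (intro sum.cong refl) (auto simp: sum.delta if_distrib[of "\<lambda>z. _ * z"] cong: if_cong)
  thus "(\<Sum>k<N. \<Sum>l<M. f k l * (if a = k \<and> b = l then 1 else 0)) = f a b" using assms by simp
qed

text \<open>The definition of \<open>tensor_map\<close> is of this form, after the pairs of indices are merged into one index.\<close>

lemma kernel_linear_tensor_map: "kernel_linear (2 * b) (tensor_map 2 b \<Phi> \<Psi>)"
proof -
  define c where "c x y K L = kron (\<Phi> (matrix_unit 2 (K div b) (L div b))) (\<Psi> (matrix_unit b (K mod b) (L mod b))) $$ (x, y)"
    for x y K L
  have flat: "(\<Sum>i<2. \<Sum>j<2. \<Sum>k<b. \<Sum>l<b. f (i * b + k) (j * b + l) i j k l) =
      (\<Sum>K<2*b. \<Sum>L<2*b. f K L (K div b) (L div b) (K mod b) (L mod b))"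
    for f :: "nat \<Rightarrow> nat \<Rightarrow> nat \<Rightarrow> nat \<Rightarrow> nat \<Rightarrow> nat \<Rightarrow> complex"
  proof -
    have one: "(\<Sum>K<2*b. g K (K div b) (K mod b)) = (\<Sum>i<2. \<Sum>k<b. g (i * b + k) i k)"
      for g :: "nat \<Rightarrow> nat \<Rightarrow> nat \<Rightarrow> complex"
    proof -
      have "(\<Sum>K<2*b. g K (K div b) (K mod b)) = (\<Sum>k<b. g k 0 k + g (b + k) 1 k)"
        unfolding sum_lessThan_double by (intro sum.cong refl) auto
      thus ?thesis by (simp add: eval_nat_numeral sum.distrib)
    qed
    have "(\<Sum>K<2*b. \<Sum>L<2*b. f K L (K div b) (L div b) (K mod b) (L mod b)) =
      (\<Sum>i<2. \<Sum>k<b. \<Sum>L<2*b. f (i * b + k) L i (L div b) k (L mod b))"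
      by (rule one[of "\<lambda>K i k. \<Sum>L<2*b. f K L i (L div b) k (L mod b)"])
    also have "\<dots> = (\<Sum>i<2. \<Sum>k<b. \<Sum>j<2. \<Sum>l<b. f (i * b + k) (j * b + l) i j k l)"
      by (intro sum.cong refl one)
    also have "\<dots> = (\<Sum>i<2. \<Sum>j<2. \<Sum>k<b. \<Sum>l<b. f (i * b + k) (j * b + l) i j k l)"
      by (rule sum.cong[OF refl], rule sum.swap)
    finally show ?thesis ..
  qed
  have tm: "tensor_map 2 b \<Phi> \<Psi> T $$ (x, y) = (\<Sum>K<2*b. \<Sum>L<2*b. T $$ (K, L) * c x y K L)"
    if "x < 2 * b" "y < 2 * b" for T x y
    using that flat[of "\<lambda>K L i j k l. T $$ (K, L) * kron (\<Phi> (matrix_unit 2 i j)) (\<Psi> (matrix_unit b k l)) $$ (x, y)"]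
    by (simp add: tensor_map_def c_def)
  have unit: "tensor_map 2 b \<Phi> \<Psi> (matrix_unit (2 * b) K L) $$ (x, y) = c x y K L"
    if "x < 2 * b" "y < 2 * b" "K < 2 * b" "L < 2 * b" for x y K L
  proof -
    have "tensor_map 2 b \<Phi> \<Psi> (matrix_unit (2 * b) K L) $$ (x, y) =
       (\<Sum>K'<2*b. \<Sum>L'<2*b. (if K' = K \<and> L' = L then 1 else 0) * c x y K' L')"
      unfolding tm[OF that(1,2)] by (intro sum.cong refl) simp
    thus ?thesis using sum_delta2(1)[OF that(3,4)] by simp
  qed
  show ?thesis
    unfolding kernel_linear_def
  proof (intro ballI conjI allI impI)
    fix T x y assume xy: "x < 2 * b" "y < 2 * b"
    show "tensor_map 2 b \<Phi> \<Psi> T $$ (x, y) =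
      (\<Sum>k<2 * b. \<Sum>l<2 * b. T $$ (k, l) * tensor_map 2 b \<Phi> \<Psi> (matrix_unit (2 * b) k l) $$ (x, y))"
      by (subst tm[OF xy], intro sum.cong refl) (simp add: unit[OF xy])
  qed (simp add: tensor_map_def)
qed

lemma kernel_linear_tensor_maps: "kernel_linear (2 ^ length \<Phi>s) (tensor_maps \<Phi>s)"
proof (cases \<Phi>s)
  case Nil
  show ?thesis by (simp add: Nil kernel_linear_def matrix_unit_def)
next
  case (Cons \<Phi> \<Psi>s)
  show ?thesis using kernel_linear_tensor_map[of "2 ^ length \<Psi>s" \<Phi> "tensor_maps \<Psi>s"] by (simp add: Cons)
qed

definition mat_block :: "nat \<Rightarrow> complex mat \<Rightarrow> nat \<Rightarrow> nat \<Rightarrow> complex mat" where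
  "mat_block b T i j = mat b b (\<lambda>(k, l). T $$ (i * b + k, j * b + l))"

lemma kron_index:
  assumes "A \<in> carrier_mat a a" "B \<in> carrier_mat b b" "x < a * b" "y < a * b"
  shows "kron A B $$ (x, y) = A $$ (x div b, y div b) * B $$ (x mod b, y mod b)"
  using assms by (auto simp: kron_def)

lemma div_less_two: "x < 2 * b \<Longrightarrow> x div b < (2::nat)"
  by (simp add: less_mult_imp_div_less)

text \<open>Tensoring with the identity on the left lets a map act on each block separately.\<close>

lemma tensor_map_id_left:
  assumes \<Psi>: "kernel_linear b \<Psi>" and xy: "x < 2 * b" "y < 2 * b"
  shows "tensor_map 2 b id \<Psi> T $$ (x, y) = \<Psi> (mat_block b T (x div b) (y div b)) $$ (x mod b, y mod b)"
proof -
  have b: "b > 0" using xy by (cases b) auto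
  have "tensor_map 2 b id \<Psi> T $$ (x, y) = (\<Sum>i<2. \<Sum>j<2. (\<Sum>k<b. \<Sum>l<b.
      T $$ (i * b + k, j * b + l) * \<Psi> (matrix_unit b k l) $$ (x mod b, y mod b)) * (if x div b = i \<and> y div b = j then 1 else 0))"
  proof -
    have k: "kron (matrix_unit 2 i j) (\<Psi> (matrix_unit b k l)) $$ (x, y) =
      (if x div b = i \<and> y div b = j then 1 else 0) * \<Psi> (matrix_unit b k l) $$ (x mod b, y mod b)" for i j k l
      using xy by (subst kron_index[of _ 2 _ b]) (simp_all add: kernel_linearD(1)[OF \<Psi>] div_less_two)
    show ?thesis using xy
      by (simp add: tensor_map_def k sum_distrib_left sum_distrib_right mult_ac)
  qed
  also have "\<dots> = (\<Sum>k<b. \<Sum>l<b.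
      T $$ (x div b * b + k, y div b * b + l) * \<Psi> (matrix_unit b k l) $$ (x mod b, y mod b))"
    using xy by (intro sum_delta2(2) div_less_two)
  also have "\<dots> = (\<Sum>k<b. \<Sum>l<b.
      mat_block b T (x div b) (y div b) $$ (k, l) * \<Psi> (matrix_unit b k l) $$ (x mod b, y mod b))"
    by (intro sum.cong refl) (simp add: mat_block_def)
  also have "\<dots> = \<Psi> (mat_block b T (x div b) (y div b)) $$ (x mod b, y mod b)"
    by (rule kernel_linearD(2)[OF \<Psi>, symmetric]) (use b in \<open>simp_all add: mat_block_def\<close>)
  finally show ?thesis .
qed

lemma tensor_maps_replicate_id:
  "T \<in> carrier_mat (2 ^ m) (2 ^ m) \<Longrightarrow> tensor_maps (replicate m id) T = T"
proof (induction m arbitrary: T)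
  case (Suc m)
  let ?b = "2 ^ m :: nat"
  have kl: "kernel_linear ?b (tensor_maps (replicate m id))"
    using kernel_linear_tensor_maps[of "replicate m id"] by simp
  show ?case
  proof (rule eq_matI)
    fix x y assume "x < dim_row T" "y < dim_col T"
    hence xy: "x < 2 * ?b" "y < 2 * ?b" using Suc.prems by auto
    have "tensor_maps (replicate (Suc m) id) T $$ (x, y) =
       tensor_maps (replicate m id) (mat_block ?b T (x div ?b) (y div ?b)) $$ (x mod ?b, y mod ?b)"
      using tensor_map_id_left[OF kl xy] by simp
    also have "\<dots> = mat_block ?b T (x div ?b) (y div ?b) $$ (x mod ?b, y mod ?b)"
      by (subst Suc.IH) (auto simp: mat_block_def)
    also have "\<dots> = T $$ (x, y)" by (simp add: mat_block_def div_mult_mod_eq)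
    finally show "tensor_maps (replicate (Suc m) id) T $$ (x, y) = T $$ (x, y)" .
  qed (use Suc.prems in \<open>auto simp: tensor_map_def\<close>)
qed simp

lemma D_map_matrix_unit:
  assumes "i < 2" "j < 2" "x < 2" "y < 2"
  shows "D_map (matrix_unit 2 i j) $$ (x, y) =
    (if x = i \<and> y = j then 1 else 0) - (if i = j \<and> x = y then 1/2 else 0)"
proof -
  have "ntrace (matrix_unit 2 i j) = (if i = j then 1/2 else 0)"
    using assms by (auto simp: ntrace_def matrix_unit_def eval_nat_numeral less_Suc_eq)
  thus ?thesis using assms by (auto simp: D_map_def matrix_unit_def)
qed

lemma D_map_carrier: "A \<in> carrier_mat 2 2 \<Longrightarrow> D_map A \<in> carrier_mat 2 2"
  by (auto simp: D_map_def)

lemma tensor_map_D_left: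
  assumes \<Psi>: "\<And>T. T \<in> carrier_mat b b \<Longrightarrow> \<Psi> T = T" and xy: "x < 2 * b" "y < 2 * b"
  shows "tensor_map 2 b D_map \<Psi> T $$ (x, y) =
    T $$ (x, y) - (if x div b = y div b then (T $$ (x mod b, y mod b) + T $$ (b + x mod b, b + y mod b)) / 2 else 0)"
proof -
  have b: "b > 0" using xy by (cases b) auto
  note d2 = div_less_two[OF xy(1)] div_less_two[OF xy(2)]
  have m: "x mod b < b" "y mod b < b" using b by auto
  have k: "kron (D_map (matrix_unit 2 i j)) (\<Psi> (matrix_unit b k l)) $$ (x, y) =
      D_map (matrix_unit 2 i j) $$ (x div b, y div b) * (if x mod b = k \<and> y mod b = l then 1 else 0)" for i j k l
    using xy b by (subst kron_index[of _ 2 _ b]) (simp_all add: \<Psi> D_map_carrier)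
  have "tensor_map 2 b D_map \<Psi> T $$ (x, y) = (\<Sum>i<2. \<Sum>j<2. \<Sum>k<b. \<Sum>l<b.
      (T $$ (i * b + k, j * b + l) * D_map (matrix_unit 2 i j) $$ (x div b, y div b)) * (if x mod b = k \<and> y mod b = l then 1 else 0))"
    using xy by (simp add: tensor_map_def k mult.assoc)
  also have "\<dots> = (\<Sum>i<2. \<Sum>j<2. T $$ (i * b + x mod b, j * b + y mod b) * D_map (matrix_unit 2 i j) $$ (x div b, y div b))"
    by (intro sum.cong refl sum_delta2(2) m)
  also have "\<dots> = (\<Sum>i<2. \<Sum>j<2. T $$ (i * b + x mod b, j * b + y mod b) *
     ((if x div b = i \<and> y div b = j then 1 else 0) - (if i = j \<and> x div b = y div b then 1/2 else 0)))"
    using d2 by (intro sum.cong refl) (simp add: D_map_matrix_unit)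
  also have "\<dots> = T $$ (x div b * b + x mod b, y div b * b + y mod b) -
      (\<Sum>i<2. \<Sum>j<2. T $$ (i * b + x mod b, j * b + y mod b) * (if i = j \<and> x div b = y div b then 1/2 else 0))"
    unfolding right_diff_distrib sum_subtractf using d2 by (subst sum_delta2(2)) auto
  also have "(\<Sum>i<2. \<Sum>j<2. T $$ (i * b + x mod b, j * b + y mod b) * (if i = j \<and> x div b = y div b then 1/2 else 0))
     = (if x div b = y div b then (T $$ (x mod b, y mod b) + T $$ (b + x mod b, b + y mod b)) / 2 else 0)"
    by (simp add: eval_nat_numeral add_divide_distrib)
  finally show ?thesis by (simp only: div_mult_mod_eq)
qed

lemma tensor_maps_carrier:
  assumes "T \<in> carrier_mat (2 ^ length \<Phi>s) (2 ^ length \<Phi>s)"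
  shows "tensor_maps \<Phi>s T \<in> carrier_mat (2 ^ length \<Phi>s) (2 ^ length \<Phi>s)"
  by (rule kernel_linearD(1)[OF kernel_linear_tensor_maps assms])

lemma tensor_maps_derivative:
  assumes "T \<in> carrier_mat (2 ^ Suc (j + m)) (2 ^ Suc (j + m))" "x < 2 ^ Suc (j + m)" "y < 2 ^ Suc (j + m)"
  shows "tensor_maps (replicate j id @ D_map # replicate m id) T $$ (x, y) = deriv_fun m j (entries T) x y"
  using assms
proof (induction j arbitrary: T x y)
  case 0
  hence xy: "x < 2 * 2 ^ m" "y < 2 * 2 ^ m" by simp_all
  have "tensor_map 2 (2 ^ m) D_map (tensor_maps (replicate m id)) T $$ (x, y) = deriv_fun m 0 (entries T) x y"
    unfolding deriv_fun_def entries_def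
    by (subst tensor_map_D_left[OF tensor_maps_replicate_id xy]) (simp_all add: component_def)
  thus ?case by (simp only: replicate_0 append_Nil tensor_maps.simps length_replicate)
next
  case (Suc j)
  define b :: nat where "b = 2 ^ Suc (j + m)"
  define \<Psi> where "\<Psi> = tensor_maps (replicate j id @ D_map # replicate m id)"
  have xy: "x < 2 * b" "y < 2 * b" using Suc.prems by (simp_all add: b_def)
  have b0: "b > 0" by (simp add: b_def)
  have kl: "kernel_linear b \<Psi>"
    using kernel_linear_tensor_maps[of "replicate j id @ D_map # replicate m id"] by (simp add: b_def \<Psi>_def)
  let ?B = "mat_block b T (x div b) (y div b)"
  have "tensor_maps (replicate (Suc j) id @ D_map # replicate m id) T $$ (x, y) = tensor_map 2 b id \<Psi> T $$ (x, y)"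
    by (simp add: b_def \<Psi>_def)
  also have "\<dots> = \<Psi> ?B $$ (x mod b, y mod b)"
    by (rule tensor_map_id_left[OF kl xy])
  also have "\<dots> = deriv_fun m j (entries ?B) (x mod b) (y mod b)"
    unfolding \<Psi>_def b_def by (rule Suc.IH) (simp_all add: mat_block_def)
  also have "\<dots> = deriv_fun m j (fun_block b (entries T) (x div b) (y div b)) (x mod b) (y mod b)"
  proof -
    have "entries ?B k l = fun_block b (entries T) (x div b) (y div b) k l" if "k < b" "l < b" for k l
      using that by (simp add: entries_def mat_block_def fun_block_def)
    thus ?thesis
      using cond_exp_cong[of j m "entries ?B" "fun_block b (entries T) (x div b) (y div b)" "x mod b" "y mod b"] b0
      unfolding deriv_fun_def b_def[symmetric] by simp
  qed
  also have "\<dots> = deriv_fun m (Suc j) (entries T) x y"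
    unfolding deriv_fun_def cond_exp.simps(2) b_def[symmetric] by (simp add: fun_block_def div_mult_mod_eq)
  finally show ?case .
qed

lemma partial_deriv_carrier:
  assumes "T \<in> carrier_mat (2 ^ Suc (j + m)) (2 ^ Suc (j + m))"
  shows "partial_deriv (Suc (j + m)) (Suc j) T \<in> carrier_mat (2 ^ Suc (j + m)) (2 ^ Suc (j + m))"
  using assms tensor_maps_carrier[of T "replicate j id @ D_map # replicate m id"]
  by (simp add: partial_deriv_def)

lemma entries_partial_deriv:
  assumes "T \<in> carrier_mat (2 ^ Suc (j + m)) (2 ^ Suc (j + m))" "x < 2 ^ Suc (j + m)" "y < 2 ^ Suc (j + m)"
  shows "entries (partial_deriv (Suc (j + m)) (Suc j) T) x y = deriv_fun m j (entries T) x y"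
  using tensor_maps_derivative[OF assms] by (simp add: partial_deriv_def entries_def)

section \<open>Norms and variance in coordinates\<close>

lemma conjugated_diag_index:
  assumes "U \<in> carrier_mat N N" "i < N" "j < N"
  shows "(U * mat_diag N e * mat_adjoint U) $$ (i, j) = (\<Sum>k<N. U $$ (i, k) * e k * cnj (U $$ (j, k)))"
proof -
  have "(U * mat_diag N e * mat_adjoint U) $$ (i, j) = (\<Sum>k<N. (U * mat_diag N e) $$ (i, k) * mat_adjoint U $$ (k, j))"
    using assms mat_diag_dim[of N e] by (auto simp: scalar_prod_def lessThan_atLeast0 simp del: mat_diag_dim intro!: sum.cong)
  thus ?thesis using assms by (simp add: mat_diag_mult_right[OF assms(1)])
qed

lemma unitary_entries:
  assumes U: "U \<in> carrier_mat N N" and "mat_adjoint U * U = 1\<^sub>m N" "U * mat_adjoint U = 1\<^sub>m N"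
  shows "unitary N (entries U)"
proof -
  have "(mat_adjoint U * U) $$ (k, l) = (\<Sum>i<N. cnj (entries U i k) * entries U i l)" if "k < N" "l < N" for k l
    using that U by (auto simp: scalar_prod_def lessThan_atLeast0 entries_def intro!: sum.cong)
  moreover have "(U * mat_adjoint U) $$ (i, j) = (\<Sum>k<N. entries U i k * cnj (entries U j k))" if "i < N" "j < N" for i j
    using that U by (auto simp: scalar_prod_def lessThan_atLeast0 entries_def intro!: sum.cong)
  ultimately show ?thesis using assms by (auto simp: unitary_def)
qed

lemma trace_conjugated_diag:
  assumes U: "U \<in> carrier_mat N N" and "mat_adjoint U * U = 1\<^sub>m N" "U * mat_adjoint U = 1\<^sub>m N"
  shows "ntrace (U * mat_diag N (\<lambda>i. complex_of_real (e i)) * mat_adjoint U) = complex_of_real ((\<Sum>k<N. e k) / N)"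
proof -
  let ?A = "U * mat_diag N (\<lambda>i. complex_of_real (e i)) * mat_adjoint U"
  have "(\<Sum>i<N. ?A $$ (i, i)) = (\<Sum>i<N. \<Sum>k<N. e k * (cmod (U $$ (i, k)))\<^sup>2)"
    unfolding of_real_sum of_real_mult complex_norm_square
    by (intro sum.cong refl) (simp add: conjugated_diag_index[OF U] mult_ac)
  also have "(\<Sum>i<N. \<Sum>k<N. e k * (cmod (U $$ (i, k)))\<^sup>2) = (\<Sum>k<N. \<Sum>i<N. e k * (cmod (U $$ (i, k)))\<^sup>2)"
    by (rule sum.swap)
  also have "\<dots> = (\<Sum>k<N. e k)"
    using unitary_column_norm[OF unitary_entries[OF assms]] by (simp add: sum_distrib_left[symmetric] entries_def)
  finally show ?thesis using U by (simp add: ntrace_def)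
qed

lemma similar_mat_wit_square:
  assumes "similar_mat_wit A (mat_diag N (\<lambda>i. complex_of_real (d i))) U V" "A \<in> carrier_mat N N"
  shows "similar_mat_wit (A * A) (mat_diag N (\<lambda>i. complex_of_real ((d i)\<^sup>2))) U V"
proof -
  have "similar_mat_wit (A ^\<^sub>m 2) (mat_diag N (\<lambda>i. complex_of_real (d i)) ^\<^sub>m 2) U V"
    using assms(1) by (rule similar_mat_wit_pow)
  thus ?thesis using assms(2) by (simp add: numeral_2_eq_2 power2_eq_square)
qed

lemma similar_mat_wit_conjugated_diag:
  assumes "similar_mat_wit A (mat_diag N d) U V" "A \<in> carrier_mat N N"
  shows "similar_mat_wit (U * mat_diag N e * V) (mat_diag N e) U V"
  using similar_mat_witD2[OF assms(2,1)] by (intro similar_mat_witI[of _ _ N]) auto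

context
  fixes A U :: "complex mat" and N :: nat and d :: "nat \<Rightarrow> real"
  assumes A: "A \<in> carrier_mat N N" and hA: "mat_adjoint A = A"
    and wit: "similar_mat_wit A (mat_diag N (\<lambda>i. complex_of_real (d i))) U (mat_adjoint U)"
begin

lemma mat_abs_diagonalized:
  "mat_abs A = U * mat_diag N (\<lambda>i. complex_of_real \<bar>d i\<bar>) * mat_adjoint U"
  using hermitian_fun_eqI[OF _ similar_mat_wit_square[OF wit A], of sqrt] A
  by (simp add: mat_abs_def hA)

lemma mat_abs_wit:
  "mat_abs A \<in> carrier_mat N N"
  "similar_mat_wit (mat_abs A) (mat_diag N (\<lambda>i. complex_of_real \<bar>d i\<bar>)) U (mat_adjoint U)"
  using similar_mat_wit_conjugated_diag[OF wit A, of "\<lambda>i. complex_of_real \<bar>d i\<bar>"] similar_mat_witD2[OF A wit]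
  unfolding mat_abs_diagonalized by auto

lemma unitary_wit: "U \<in> carrier_mat N N" "mat_adjoint U * U = 1\<^sub>m N" "U * mat_adjoint U = 1\<^sub>m N"
  using similar_mat_witD2[OF A wit] by auto

text \<open>For a Hermitian matrix, \<open>|A|\<close> is diagonal in the same basis with the moduli of the eigenvalues.\<close>

lemma Lp_norm_powr:
  assumes "p > 0"
  shows "Lp_norm p A powr p = (\<Sum>k<N. \<bar>d k\<bar> powr p) / N"
proof -
  have "hermitian_fun (\<lambda>x. x powr p) (mat_abs A)
     = U * mat_diag N (\<lambda>i. complex_of_real (\<bar>d i\<bar> powr p)) * mat_adjoint U"
    by (rule hermitian_fun_eqI[OF mat_abs_wit])
  hence "Lp_norm p A = ((\<Sum>k<N. \<bar>d k\<bar> powr p) / N) powr (1 / p)"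
    by (simp add: Lp_norm_def trace_conjugated_diag[OF unitary_wit])
  thus ?thesis using assms by (simp add: powr_powr sum_nonneg)
qed

lemma diagonalizes_entries: "diagonalizes N (entries A) (entries U) d"
  unfolding diagonalizes_def
  using unitary_entries[OF unitary_wit] conjugated_diag_index[OF unitary_wit(1)] similar_mat_witD2(3)[OF A wit]
  by (simp add: entries_def)

lemma variance_eq: "variance A = hs_sq N (entries A) / N - (cmod (ntrace A))\<^sup>2"
proof -
  have "mat_abs A ^\<^sub>m 2 = U * mat_diag N (\<lambda>i. complex_of_real ((d i)\<^sup>2)) * mat_adjoint U"
    using similar_mat_witD2(3)[OF _ similar_mat_wit_square[OF mat_abs_wit(2,1)], of N N] mat_abs_wit(1)
    by (simp add: numeral_2_eq_2)
  hence "ntrace (mat_abs A ^\<^sub>m 2) = complex_of_real ((\<Sum>k<N. (d k)\<^sup>2) / N)"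
    by (simp only: trace_conjugated_diag[OF unitary_wit])
  thus ?thesis
    by (simp add: variance_def hs_sq_diagonalized[OF diagonalizes_entries] del: of_real_sum of_real_divide)
qed

end

lemma sum_diagonal_eq_fourier: "(\<Sum>i<2^n. F i i) = 2 ^ n * fourier n F (replicate n 0)"
proof (induction n arbitrary: F)
  case (Suc n)
  have "(\<Sum>i<2 * 2^n. F i i) = 2 * (\<Sum>i<2^n. component (2 ^ n) F 0 i i)"
    unfolding sum_lessThan_double sum_distrib_left by (intro sum.cong refl) (simp add: component_def)
  thus ?case by (simp add: Suc.IH)
qed simp

text \<open>The word of zeros is the only one of weight 0.\<close>

lemma sum_weight_zero:
  "(\<Sum>s\<in>indices n. if weight s = 0 then f s else (0::real)) = f (replicate n 0)"
proof (induction n arbitrary: f)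
  case (Suc n)
  show ?case unfolding sum_indices_Suc sum_lessThan_4 using Suc.IH[of "\<lambda>s. f (0 # s)"] by simp
qed simp

lemma variance_eq_fourier:
  assumes "T \<in> carrier_mat (2 ^ n) (2 ^ n)" "mat_adjoint T = T"
  shows "variance T = (\<Sum>s\<in>indices n. if weight s = 0 then 0 else (cmod (fourier n (entries T) s))\<^sup>2)"
proof -
  let ?f = "\<lambda>s. (cmod (fourier n (entries T) s))\<^sup>2"
  obtain U d where wit: "similar_mat_wit T (mat_diag (2 ^ n) (\<lambda>i. complex_of_real (d i))) U (mat_adjoint U)"
    using hermitian_diagonalizable[OF assms] by blast
  have "ntrace T = fourier n (entries T) (replicate n 0)"
    using sum_diagonal_eq_fourier[where F = "entries T" and n = n] assms(1) by (simp add: ntrace_def entries_def)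
  hence "variance T = (\<Sum>s\<in>indices n. ?f s) - (\<Sum>s\<in>indices n. if weight s = 0 then ?f s else 0)"
    using variance_eq[OF assms wit] by (simp add: parseval_hs_sq sum_weight_zero)
  also have "\<dots> = (\<Sum>s\<in>indices n. if weight s = 0 then 0 else ?f s)"
    unfolding sum_subtractf[symmetric] by (intro sum.cong) auto
  finally show ?thesis .
qed

lemma sesq_entries:
  assumes "T \<in> carrier_mat N N"
  shows "(T *\<^sub>v vec N v) \<bullet>c vec N v = sesq N (entries T) v v"
proof -
  have "(T *\<^sub>v vec N v) \<bullet>c vec N v = (\<Sum>i<N. (\<Sum>j<N. T $$ (i, j) * v j) * cnj (v i))"
    using assms by (auto simp: scalar_prod_def lessThan_atLeast0 intro!: sum.cong)
  thus ?thesis by (simp add: sesq_def entries_def sum_distrib_left sum_distrib_right mult_ac)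
qed

lemma loewner_bounds:
  assumes "loewner_le N (0\<^sub>m N N) T" "loewner_le N T (1\<^sub>m N)"
  shows "mat_adjoint T = T" "0 \<le> Re (sesq N (entries T) v v)" "Re (sesq N (entries T) v v) \<le> (\<Sum>i<N. (cmod (v i))\<^sup>2)"
proof -
  have T: "T \<in> carrier_mat N N" using assms by (simp add: loewner_le_def)
  hence T0: "T - 0\<^sub>m N N = T" by auto
  from assms(1) have psd: "psd N T" by (simp add: loewner_le_def T0)
  thus "mat_adjoint T = T" by (simp add: psd_def)
  have "0 \<le> (T *\<^sub>v vec N v) \<bullet>c vec N v" using psd by (simp add: psd_def)
  thus "0 \<le> Re (sesq N (entries T) v v)" by (simp add: sesq_entries[OF T] less_eq_complex_def)
  have "0 \<le> ((1\<^sub>m N - T) *\<^sub>v vec N v) \<bullet>c vec N v" using assms(2) by (simp add: loewner_le_def psd_def)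
  hence "0 \<le> Re (sesq N (entries (1\<^sub>m N - T)) v v)"
    using sesq_entries[of "1\<^sub>m N - T" N v] minus_carrier_mat[OF T, of "1\<^sub>m N"] by (simp add: less_eq_complex_def)
  also have "sesq N (entries (1\<^sub>m N - T)) v v = (\<Sum>i<N. \<Sum>j<N. cnj (v i) * (if i = j then 1 else 0) * v j) - sesq N (entries T) v v"
    using T by (simp add: sesq_def entries_def sum_subtractf[symmetric] algebra_simps)
  also have "(\<Sum>i<N. \<Sum>j<N. cnj (v i) * (if i = j then 1 else 0) * v j) = complex_of_real (\<Sum>i<N. (cmod (v i))\<^sup>2)"
    unfolding of_real_sum complex_norm_square
  proof (intro sum.cong refl)
    fix i assume i: "i \<in> {..<N}"
    have "(\<Sum>j<N. cnj (v i) * (if i = j then 1 else 0) * v j) = (\<Sum>j<N. if i = j then v i * cnj (v i) else 0)"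
      by (intro sum.cong) auto
    thus "(\<Sum>j<N. cnj (v i) * (if i = j then 1 else 0) * v j) = v i * cnj (v i)" using i by simp
  qed
  finally show "Re (sesq N (entries T) v v) \<le> (\<Sum>i<N. (cmod (v i))\<^sup>2)" by simp
qed

section \<open>The inequality between the influences\<close>

text \<open>What \<open>influence_inequality\<close> has to know about a derivative. It is Hermitian, since the conditional expectation commutes with
  adjoints; the bound on an eigenvalue comes from the quadratic form at a unit eigenvector.\<close>

lemma partial_deriv_spectrum:
  assumes T: "T \<in> carrier_mat (2 ^ n) (2 ^ n)" and j: "j < n"
    and lo: "loewner_le (2 ^ n) (0\<^sub>m (2 ^ n) (2 ^ n)) T" and hi: "loewner_le (2 ^ n) T (1\<^sub>m (2 ^ n))"
  obtains U d where "diagonalizes (2 ^ n) (entries (partial_deriv n (Suc j) T)) U d"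
    "\<And>k. k < 2 ^ n \<Longrightarrow> \<bar>d k\<bar> \<le> 1"
    "\<And>p. p > 0 \<Longrightarrow> Lp_norm p (partial_deriv n (Suc j) T) powr p = (\<Sum>k<2^n. \<bar>d k\<bar> powr p) / 2 ^ n"
    "\<And>s. s \<in> indices n \<Longrightarrow> fourier n (entries (partial_deriv n (Suc j) T)) s = (if s ! j = 0 then 0 else fourier n (entries T) s)"
proof -
  define m where "m = n - Suc j"
  have n: "n = Suc (j + m)" using j by (simp add: m_def)
  define G where "G = partial_deriv n (Suc j) T"
  have G: "G \<in> carrier_mat (2 ^ n) (2 ^ n)" using partial_deriv_carrier T by (simp only: G_def n)
  have e: "entries G x y = deriv_fun m j (entries T) x y" if "x < 2 ^ n" "y < 2 ^ n" for x y
    using entries_partial_deriv T that by (simp only: G_def n)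
  have hT: "mat_adjoint T = T" by (rule loewner_bounds(1)[OF lo hi])
  have Ti: "cnj (entries T y x) = entries T x y" if "x < 2 ^ n" "y < 2 ^ n" for x y
    using mat_adjoint_index[of x T y] that T by (simp add: entries_def hT)
  have hG: "mat_adjoint G = G"
  proof (rule eq_matI)
    fix x y assume "x < dim_row G" "y < dim_col G"
    hence xy: "x < 2 ^ n" "y < 2 ^ n" using G by auto
    have "cnj (cond_exp m j (entries T) y x) = cond_exp m j (\<lambda>x y. cnj (entries T y x)) x y" by (rule cnj_cond_exp)
    also have "\<dots> = cond_exp m j (entries T) x y"
      by (rule cond_exp_cong) (use Ti xy in \<open>simp_all only: n\<close>)
    finally have "cnj (entries G y x) = entries G x y"
      using xy by (simp add: e deriv_fun_def Ti)
    thus "mat_adjoint G $$ (x, y) = G $$ (x, y)"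
      using xy G by (simp add: entries_def)
  qed (use G in auto)
  obtain U d where wit: "similar_mat_wit G (mat_diag (2 ^ n) (\<lambda>i. complex_of_real (d i))) U (mat_adjoint U)"
    using hermitian_diagonalizable[OF G hG] by blast
  have diag: "diagonalizes (2 ^ n) (entries G) (entries U) d"
    by (rule diagonalizes_entries[OF G hG wit])
  have "\<bar>d k\<bar> \<le> 1" if k: "k < 2 ^ n" for k
  proof -
    let ?u = "\<lambda>i. entries U i k"
    have "sesq (2 ^ n) (entries G) ?u ?u = sesq (2 ^ n) (deriv_fun m j (entries T)) ?u ?u"
      by (rule sesq_cong) (simp_all add: e)
    moreover have "\<bar>Re (sesq (2 ^ n) (deriv_fun m j (entries T)) ?u ?u)\<bar> \<le> (\<Sum>x<2 ^ n. (cmod (?u x))\<^sup>2)"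
      using sesq_deriv_fun_bounds[of j m "entries T" ?u] loewner_bounds(2,3)[OF lo hi] by (simp only: n)
    moreover have "(\<Sum>x<2 ^ n. (cmod (?u x))\<^sup>2) = 1"
      using diag k by (intro unitary_column_norm) (auto simp: diagonalizes_def)
    ultimately have "\<bar>Re (sesq (2 ^ n) (entries G) ?u ?u)\<bar> \<le> 1" by simp
    thus ?thesis unfolding sesq_eigenvector[OF diag k] by simp
  qed
  moreover have "fourier n (entries G) s = (if s ! j = 0 then 0 else fourier n (entries T) s)" if "s \<in> indices n" for s
  proof -
    have "fourier n (entries G) s = fourier n (deriv_fun m j (entries T)) s"
      by (rule fourier_cong) (rule e)
    thus ?thesis using fourier_deriv_fun[of s j m "entries T"] that by (simp only: n)
  qed
  ultimately show ?thesis
    using that diag Lp_norm_powr[OF G hG wit] by (simp add: G_def)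
qed

theorem theorem1p8:
  shows "\<exists>K::real. K > 0 \<and>
    (\<forall>(n::nat) (p::real) (T::complex mat).
      1 \<le> n \<longrightarrow> 1 \<le> p \<longrightarrow> p < 2 \<longrightarrow>
      T \<in> carrier_mat (2 ^ n) (2 ^ n) \<longrightarrow>
      loewner_le (2 ^ n) (0\<^sub>m (2 ^ n) (2 ^ n)) T \<longrightarrow>
      loewner_le (2 ^ n) T (1\<^sub>m (2 ^ n)) \<longrightarrow>
      variance T > 0 \<longrightarrow>
      (MAX j\<in>{1..n}. Lp_norm p (partial_deriv n j T) powr p) \<ge>
        1 / 4 * exp (- (K / (2 - p)) *
          ((\<Sum>j=1..n. Lp_norm p (partial_deriv n j T) powr p) / variance T)))"
proof (intro exI[of _ "4 + 8 * ln 5"] conjI allI impI)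
  show "4 + 8 * ln 5 > (0::real)" by (simp add: add_pos_pos)
next
  fix n :: nat and p :: real and T :: "complex mat"
  assume n: "1 \<le> n" and p: "1 \<le> p" "p < 2" and T: "T \<in> carrier_mat (2 ^ n) (2 ^ n)"
    and lo: "loewner_le (2 ^ n) (0\<^sub>m (2 ^ n) (2 ^ n)) T" and hi: "loewner_le (2 ^ n) T (1\<^sub>m (2 ^ n))"
    and var: "variance T > 0"
  define I where "I j = Lp_norm p (partial_deriv n (Suc j) T) powr p" for j
  define P where "P j U d \<longleftrightarrow> diagonalizes (2 ^ n) (entries (partial_deriv n (Suc j) T)) U d \<and>
    (\<forall>k<2^n. \<bar>d k\<bar> \<le> 1) \<and> I j = (\<Sum>k<2^n. \<bar>d k\<bar> powr p) / 2 ^ n \<and>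
    (\<forall>s\<in>indices n. fourier n (entries (partial_deriv n (Suc j) T)) s = (if s ! j = 0 then 0 else fourier n (entries T) s))"
    for j U and d :: "nat \<Rightarrow> real"
  have "\<exists>U d. P j U d" if j: "j < n" for j
  proof (rule partial_deriv_spectrum[OF T j lo hi])
    fix U d
    assume "diagonalizes (2 ^ n) (entries (partial_deriv n (Suc j) T)) U d"
      and "\<And>k. k < 2 ^ n \<Longrightarrow> \<bar>d k\<bar> \<le> 1"
      and "\<And>p. p > 0 \<Longrightarrow> Lp_norm p (partial_deriv n (Suc j) T) powr p = (\<Sum>k<2^n. \<bar>d k\<bar> powr p) / 2 ^ n"
      and "\<And>s. s \<in> indices n \<Longrightarrow> fourier n (entries (partial_deriv n (Suc j) T)) s = (if s ! j = 0 then 0 else fourier n (entries T) s)"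
    hence "P j U d"
      unfolding P_def I_def using p by (intro conjI allI ballI impI) simp_all
    thus ?thesis by blast
  qed
  then obtain U d where Ud: "P j (U j) (d j)" if "j < n" for j by metis
  have diag: "diagonalizes (2 ^ n) (entries (partial_deriv n (Suc j) T)) (U j) (d j)"
    and I: "I j = (\<Sum>k<2^n. \<bar>d j k\<bar> powr p) / 2 ^ n" if "j < n" for j
    using Ud[OF that] by (simp_all only: P_def)
  have d1: "\<bar>d j k\<bar> \<le> 1" if "j < n" "k < 2 ^ n" for j k
    using Ud[OF that(1)] that(2) by (simp only: P_def)
  have fourier: "fourier n (entries (partial_deriv n (Suc j) T)) s = (if s ! j = 0 then 0 else fourier n (entries T) s)"
    if "j < n" "s \<in> indices n" for j s
    using Ud[OF that(1)] that(2) by (simp only: P_def)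
  note v = variance_eq_fourier[OF T loewner_bounds(1)[OF lo hi]]
  have "exp (- ((4 + 8 * ln 5) / (2 - p)) * ((\<Sum>j<n. (\<Sum>k<2^n. \<bar>d j k\<bar> powr p) / 2 ^ n) / variance T))
     \<le> Max ((\<lambda>j. (\<Sum>k<2^n. \<bar>d j k\<bar> powr p) / 2 ^ n) ` {..<n})"
    unfolding v
    by (rule influence_inequality[OF p fourier diag d1 var[unfolded v]])
  hence main: "exp (- ((4 + 8 * ln 5) / (2 - p)) * ((\<Sum>j<n. I j) / variance T)) \<le> Max (I ` {..<n})"
    by (simp add: I cong: image_cong_simp)
  have set: "{1..n} = Suc ` {..<n}" by (auto simp: image_iff Suc_le_eq gr0_conv_Suc)
  have mx: "(MAX j\<in>{1..n}. Lp_norm p (partial_deriv n j T) powr p) = Max (I ` {..<n})"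
    unfolding set image_image I_def ..
  have sm: "(\<Sum>j=1..n. Lp_norm p (partial_deriv n j T) powr p) = (\<Sum>j<n. I j)"
    unfolding set I_def by (simp add: sum.reindex)
  have "1 / 4 * exp z \<le> exp z" for z :: real by simp
  thus "(MAX j\<in>{1..n}. Lp_norm p (partial_deriv n j T) powr p) \<ge>
        1 / 4 * exp (- ((4 + 8 * ln 5) / (2 - p)) *
          ((\<Sum>j=1..n. Lp_norm p (partial_deriv n j T) powr p) / variance T))"
    unfolding mx sm using main by (rule order_trans)
qed

end
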